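(* The $g$-vector of a rationally represented coloop-free matroid is a Macaulay vector: if $M$ is a matroid of rank $n-d$ on $n$ elements, representable over $\mathbb{Q}$ and without coloops, with $g$-vector $(g_1,\dots,g_{\lfloor (n-d)/2\rfloor})$, then there exists a graded $\mathbb{Q}$-algebra $R=R_0\oplus R_1\oplus\cdots\oplus R_{\lfloor (n-d)/2\rfloor}$ generated by $R_1$ and with $g_i=\dim_{\mathbb{Q}}(R_i)$ for all $i$.
   Context: Graded $\mathbb{Q}$-algebras are commutative with $R_0=\mathbb{Q}$. A matroid $M$ is rationally represented by a vector configuration $b_1,\dots,b_n\in\mathbb{Z}^{n-d}$ of rank $n-d$ (independent sets are the linearly independent subfamilies); a coloop is an element lying in every basis. The $h$-vector $h(M)=(h_0,\dots,h_{n-d})$ is the $h$-vector of the independence complex: if $f_{i-1}$ is the number of independent sets of cardinality $i$ and $m=n-d$, then $\sum_{i=0}^{m}f_{i-1}(t-1)^{m-i}=\sum_{i=0}^{m}h_it^{m-i}$. The $g$-vector is $g(M)=(g_1,\dots,g_{\lfloor (n-d)/2\rfloor})$ with $g_i=h_i-h_{i-1}$. *)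

theory Defs
  imports "Jordan_Normal_Form.VS_Connect" "HOL-Algebra.Generated_Rings"
begin

section \<open>Matroids\<close>

locale matroid =
  fixes E :: "'a set" and indep :: "'a set \<Rightarrow> bool"
  assumes finite_ground: "finite E"
    and indep_subset_ground: "indep I \<Longrightarrow> I \<subseteq> E"
    and indep_empty: "indep {}"
    and indep_subset: "indep J \<Longrightarrow> I \<subseteq> J \<Longrightarrow> indep I"
    and indep_augment:
      "indep I \<Longrightarrow> indep J \<Longrightarrow> card I < card J \<Longrightarrow> \<exists>x\<in>J - I. indep (insert x I)"

definition matroid_rank :: "('a set \<Rightarrow> bool) \<Rightarrow> nat" where
  "matroid_rank indep = Max (card ` {I. indep I})"

definition matroid_basis :: "('a set \<Rightarrow> bool) \<Rightarrow> 'a set \<Rightarrow> bool" where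
  "matroid_basis indep B \<longleftrightarrow> indep B \<and> (\<forall>I. indep I \<and> B \<subseteq> I \<longrightarrow> I = B)"

definition coloop :: "'a set \<Rightarrow> ('a set \<Rightarrow> bool) \<Rightarrow> 'a \<Rightarrow> bool" where
  "coloop E indep e \<longleftrightarrow> e \<in> E \<and> (\<forall>B. matroid_basis indep B \<longrightarrow> e \<in> B)"

definition rat_vec :: "int vec \<Rightarrow> rat vec" where
  "rat_vec v = map_vec rat_of_int v"

text \<open>
  A subfamily \<open>(b e)\<^sub>e\<close> with \<open>e \<in> I\<close> is linearly independent over the rationals if the
  vectors are pairwise distinct and form a linearly independent set; so parallel copies of the same
  vector are dependent.
\<close>

definition lin_indep_subfamily :: "nat \<Rightarrow> ('a \<Rightarrow> int vec) \<Rightarrow> 'a set \<Rightarrow> bool" where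
  "lin_indep_subfamily m b I \<longleftrightarrow>
     inj_on (\<lambda>e. rat_vec (b e)) I \<and>
     module.lin_indpt class_ring (module_vec TYPE(rat) m) ((\<lambda>e. rat_vec (b e)) ` I)"

definition config_rank :: "nat \<Rightarrow> ('a \<Rightarrow> int vec) \<Rightarrow> 'a set \<Rightarrow> nat" where
  "config_rank m b E =
     vectorspace.dim class_ring
       (module.span_vs class_ring (module_vec TYPE(rat) m) ((\<lambda>e. rat_vec (b e)) ` E))"

definition rationally_represents ::
    "nat \<Rightarrow> ('a \<Rightarrow> int vec) \<Rightarrow> 'a set \<Rightarrow> ('a set \<Rightarrow> bool) \<Rightarrow> bool" where
  "rationally_represents m b E indep \<longleftrightarrow>
     (\<forall>e\<in>E. b e \<in> carrier_vec m) \<and> config_rank m b E = m \<and>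
     (\<forall>I. I \<subseteq> E \<longrightarrow> (indep I \<longleftrightarrow> lin_indep_subfamily m b I))"


section \<open>The h-vector and the g-vector\<close>

text \<open>\<open>indep_count indep i\<close> is the face number \<open>f\<^sub>i\<^sub>-\<^sub>1\<close> of the independence complex.\<close>

definition indep_count :: "('a set \<Rightarrow> bool) \<Rightarrow> nat \<Rightarrow> nat" where
  "indep_count indep i = card {I. indep I \<and> card I = i}"

definition h_polynomial :: "('a set \<Rightarrow> bool) \<Rightarrow> int poly" where
  "h_polynomial indep =
     (\<Sum>i\<le>matroid_rank indep. of_nat (indep_count indep i) * [:-1, 1:] ^ (matroid_rank indep - i))"

text \<open>
  \<open>h\<^sub>i\<close> is the coefficient of \<open>t\<close> to the power \<open>m - i\<close>, where \<open>m\<close> is the rank. Because subtraction is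
  truncated, \<open>h_number\<close> is meaningful only for \<open>i \<le> m\<close>, and \<open>g_number\<close> only for \<open>1 \<le> i \<le> m\<close>.
\<close>

definition h_number :: "('a set \<Rightarrow> bool) \<Rightarrow> nat \<Rightarrow> int" where
  "h_number indep i = Polynomial.coeff (h_polynomial indep) (matroid_rank indep - i)"

definition g_number :: "('a set \<Rightarrow> bool) \<Rightarrow> nat \<Rightarrow> int" where
  "g_number indep i = h_number indep i - h_number indep (i - 1)"


section \<open>Graded algebras over the rationals and Macaulay vectors\<close>

text \<open>
  A commutative algebra \<open>A = gr 0 \<oplus> \<dots> \<oplus> gr k\<close> over the rationals whose degree zero part consists of
  the scalars. The convention \<open>gr i = {0}\<close> for \<open>i > k\<close> makes products of degree above \<open>k\<close> vanish.
\<close>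

locale graded_rat_algebra =
  algebra "class_ring :: rat ring" A for A :: "(rat, 'b) module" (structure) +
  fixes k :: nat and gr :: "nat \<Rightarrow> 'b set"
  assumes gr_subspace: "VectorSpace.subspace class_ring (gr i) A"
    and gr_above: "i > k \<Longrightarrow> gr i = {\<zero>\<^bsub>A\<^esub>}"
    and gr_direct_sum:
      "x \<in> carrier A \<Longrightarrow> \<exists>!c. c \<in> (\<Pi>\<^sub>E i\<in>{..k}. gr i) \<and> x = (\<Oplus>\<^bsub>A\<^esub>i\<in>{..k}. c i)"
    and gr_mult: "x \<in> gr i \<Longrightarrow> y \<in> gr j \<Longrightarrow> x \<otimes>\<^bsub>A\<^esub> y \<in> gr (i + j)"
    and gr_zero: "gr 0 = {q \<odot>\<^bsub>A\<^esub> \<one>\<^bsub>A\<^esub> | q. True}"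
    and one_neq_zero: "\<one>\<^bsub>A\<^esub> \<noteq> \<zero>\<^bsub>A\<^esub>"

text \<open>
  Since \<open>gr 0\<close> is the set of scalar multiples of one, the subring generated by \<open>gr 0\<close> and \<open>gr 1\<close> is
  the subalgebra generated by \<open>gr 1\<close>.
\<close>

definition generated_in_degree_one :: "(rat, 'b) module \<Rightarrow> (nat \<Rightarrow> 'b set) \<Rightarrow> bool" where
  "generated_in_degree_one A gr \<longleftrightarrow> generate_ring A (gr 0 \<union> gr 1) = carrier A"

definition has_rat_dim :: "(rat, 'b) module \<Rightarrow> 'b set \<Rightarrow> int \<Rightarrow> bool" where
  "has_rat_dim A W r \<longleftrightarrow>
     vectorspace.fin_dim class_ring (A\<lparr>carrier := W\<rparr>) \<and>
     int (vectorspace.dim class_ring (A\<lparr>carrier := W\<rparr>)) = r"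

text \<open>
  The vector \<open>(g 1, \<dots>, g k)\<close> is a Macaulay vector. HOL cannot quantify over the type of the elements
  of the algebra; a finite-dimensional algebra over the rationals is countable, so it loses no
  generality to let its carrier be a set of natural numbers (with arbitrary operations).
\<close>

definition macaulay_vector :: "nat \<Rightarrow> (nat \<Rightarrow> int) \<Rightarrow> bool" where
  "macaulay_vector k g \<longleftrightarrow>
     (\<exists>(A :: (rat, nat) module) gr.
        graded_rat_algebra A k gr \<and> generated_in_degree_one A gr \<and>
        (\<forall>i\<in>{1..k}. has_rat_dim A (gr i) (g i)))"

end

(*
  Let L be the space of linear relations among the vectors b_e. In the algebra Phi with basis
  phi_S (S independent) and phi_S phi_T = phi_(S u T) if S, T are disjoint with independent union,
  and 0 otherwise, consider the subalgebra A generated by the elements sum_e c_e phi_e with c in L.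

  dim A_i = h_i: both satisfy the deletion-contraction recursion. For A one only gets an inequality
  from below, but A_i lies in the space Z_i of weights on the independent i-sets that are balanced
  with respect to all functionals orthogonal to L, and for Z_i the recursion is an inequality from
  above.

  Since there are no coloops, some w in L has no zero coordinate. Multiplication by
  sum_e w_e phi_e is injective from degree i to degree i + 1 if 2 i + 1 <= rank: restricted to the
  subsets of a basis it is, up to rescaling, the inclusion map between two levels of a Boolean
  lattice. Hence A / (w), truncated in degrees above half the rank, has Hilbert function
  h_i - h_(i-1).
*)

theory Submission
  imports Defs "HOL-Library.Function_Algebras" "HOL-Library.Countable_Set"
begin

section \<open>Dimensions of spaces of rational functions\<close>

text \<open>Why two spaces are compared: taking the coefficient of phi_e has the algebra of the
  contraction in its image and the algebra of the deletion in its kernel, but generators of A do not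
  show that the kernel is no larger. For balanced weights, image and kernel are both bounded from
  above, because balancing is a linear condition that passes to contraction and deletion. Since A_i
  lies in Z_i, induction on the ground set squeezes the two.

  Reaching all of the contraction requires antiderivatives, which exist because rational numbers can
  be divided by k + 1.

  Why half the rank suffices without any Lefschetz property of A: injectivity is proved for all
  functions on independent i-sets and inherited by A_i. It is checked inside an independent set of
  size 2 i + 1, where levels i and i + 1 of the Boolean lattice have equal size and the inclusion
  map has an explicit inverse.\<close>

lemma dim_image_plus_kernel:
  fixes s1 :: "'k::field \<Rightarrow> 'b::ab_group_add \<Rightarrow> 'b" and s2 :: "'k \<Rightarrow> 'c::ab_group_add \<Rightarrow> 'c"
  assumes f: "Vector_Spaces.linear s1 s2 f"
    and V: "Modules.module.subspace s1 V"
    and B: "finite B" "V \<subseteq> Modules.module.span s1 B"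
  shows "Vector_Spaces.vector_space.dim s1 V =
    Vector_Spaces.vector_space.dim s2 (f ` V) + Vector_Spaces.vector_space.dim s1 {v \<in> V. f v = 0}"
proof -
  interpret f: Vector_Spaces.linear s1 s2 f by (rule f)
  let ?K = "{v \<in> V. f v = 0}"
  obtain C where C: "C \<subseteq> ?K" "f.vs1.independent C" "?K \<subseteq> f.vs1.span C" "card C = f.vs1.dim ?K"
    by (rule f.vs1.basis_exists)
  have "C \<subseteq> V" using C(1) by blast
  then obtain D where D: "C \<subseteq> D" "D \<subseteq> V" "f.vs1.independent D" "V \<subseteq> f.vs1.span D"
    using f.vs1.maximal_independent_subset_extend C(2) by metis
  have finD: "finite D"
    using f.vs1.independent_span_bound[OF B(1) D(3)] D(2) B(2) by blast
  let ?D' = "D - C"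
  have indD': "f.vs1.independent ?D'" using f.vs1.independent_mono D(3) by blast
  \<comment> \<open>A kernel vector in the span of \<open>?D'\<close> also expands over
    \<open>C\<close>; the two expansions use disjoint parts of the basis \<open>D\<close>.\<close>
  have inj: "inj_on f (f.vs1.span ?D')"
  proof (subst f.inj_on_iff_eq_0, rule f.vs1.subspace_span, intro ballI impI)
    fix v assume v: "v \<in> f.vs1.span ?D'" "f v = 0"
    have "v \<in> V" using f.vs1.span_minimal[OF _ V, of ?D'] D(2) v(1) by blast
    with v(2) C(3) have vC: "v \<in> f.vs1.span C" by blast
    have finC: "finite C" using finD D(1) finite_subset by blast
    obtain p where p: "v = (\<Sum>x\<in>C. s1 (p x) x)"
      using vC f.vs1.span_finite[OF finC] by auto
    obtain q where q: "v = (\<Sum>x\<in>?D'. s1 (q x) x)"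
      using v(1) f.vs1.span_finite[of ?D'] finD by auto
    let ?u = "\<lambda>x. if x \<in> C then - p x else q x"
    have "(\<Sum>x\<in>D. s1 (?u x) x) = (\<Sum>x\<in>?D'. s1 (?u x) x) + (\<Sum>x\<in>C. s1 (?u x) x)"
      using sum.subset_diff[OF D(1) finD] by blast
    also have "\<dots> = v + - v"
    proof (rule arg_cong2[where f = "(+)"])
      show "(\<Sum>x\<in>?D'. s1 (?u x) x) = v" unfolding q by (rule sum.cong) auto
      have "(\<Sum>x\<in>C. s1 (?u x) x) = (\<Sum>x\<in>C. - s1 (p x) x)"
        by (rule sum.cong) (auto simp: f.vs1.scale_minus_left)
      then show "(\<Sum>x\<in>C. s1 (?u x) x) = - v" unfolding p by (simp add: sum_negf)
    qed
    finally have "(\<Sum>x\<in>D. s1 (?u x) x) = 0" by simp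
    then have "\<And>x. x \<in> D \<Longrightarrow> ?u x = 0"
      using f.vs1.independentD[OF D(3) finD subset_refl, of ?u] by blast
    then have "\<And>x. x \<in> ?D' \<Longrightarrow> q x = 0" by (metis DiffE)
    then show "v = 0" unfolding q by (auto intro: sum.neutral)
  qed
  have ind: "f.vs2.independent (f ` ?D')"
    using f.independent_injective_image[OF indD' inj] .
  have "f ` V \<subseteq> f.vs2.span (f ` D)" using f.spans_image[OF D(4)] .
  also have "\<dots> \<subseteq> f.vs2.span (f ` ?D')"
  proof (rule f.vs2.span_minimal[OF _ f.vs2.subspace_span], rule subsetI)
    fix y assume "y \<in> f ` D"
    then obtain x where x: "x \<in> D" "y = f x" by blast
    show "y \<in> f.vs2.span (f ` ?D')"
    proof (cases "x \<in> C")
      case True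
      then have "y = 0" using C(1) x by blast
      then show ?thesis using f.vs2.span_zero by simp
    next
      case False
      with x have "y \<in> f ` ?D'" by blast
      then show ?thesis by (rule f.vs2.span_base)
    qed
  qed
  finally have sp: "f ` V \<subseteq> f.vs2.span (f ` ?D')" .
  have "card (f ` ?D') = f.vs2.dim (f ` V)"
    by (rule f.vs2.basis_card_eq_dim[OF _ sp ind]) (use D(2) in blast)
  moreover have "card (f ` ?D') = card ?D'"
    by (rule card_image, rule inj_on_subset[OF inj f.vs1.span_superset])
  moreover have "card D = f.vs1.dim V" using f.vs1.basis_card_eq_dim[OF D(2,4,3)] .
  moreover have "card D = card ?D' + card C"
    using finD D(1) by (metis card_Diff_subset card_mono finite_subset le_add_diff_inverse2)
  ultimately show ?thesis using C(4) by simp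
qed

definition fscale :: "rat \<Rightarrow> ('x \<Rightarrow> rat) \<Rightarrow> 'x \<Rightarrow> rat" where
  "fscale q v = (\<lambda>x. q * v x)"

lemma fscale_apply [simp]: "fscale q v x = q * v x"
  by (simp add: fscale_def)

interpretation fs: Vector_Spaces.vector_space "fscale :: rat \<Rightarrow> ('x \<Rightarrow> rat) \<Rightarrow> 'x \<Rightarrow> rat"
  by unfold_locales (auto simp: fun_eq_iff algebra_simps)

lemma sum_fun_apply: "sum f A x = (\<Sum>a\<in>A. f a x)"
  for f :: "'i \<Rightarrow> 'x \<Rightarrow> 'y::comm_monoid_add"
  by (induction A rule: infinite_finite_induct) auto

abbreviation flinear :: "(('x \<Rightarrow> rat) \<Rightarrow> 'y \<Rightarrow> rat) \<Rightarrow> bool" where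
  "flinear \<equiv> Vector_Spaces.linear fscale fscale"

lemma flinearI:
  assumes "\<And>v w. f (v + w) = f v + f w" "\<And>q v. f (fscale q v) = fscale q (f v)"
  shows "flinear f"
  unfolding Vector_Spaces.linear_iff using assms by (simp add: fs.vector_space_axioms)

definition funs_on :: "'x set \<Rightarrow> ('x \<Rightarrow> rat) set" where
  "funs_on X = {v. \<forall>x. x \<notin> X \<longrightarrow> v x = 0}"

lemma span_supported:
  assumes "finite X"
  obtains B :: "('x \<Rightarrow> rat) set"
  where "finite B" "card B \<le> card X" "funs_on X \<subseteq> fs.span B"
proof
  let ?e = "\<lambda>x y. if y = x then 1 else 0 :: rat"
  show "finite (?e ` X)" "card (?e ` X) \<le> card X" using assms by (auto intro: card_image_le)
  show "funs_on X \<subseteq> fs.span (?e ` X)"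
  proof
    fix v :: "'x \<Rightarrow> rat" assume "v \<in> funs_on X"
    then have v: "\<forall>x. x \<notin> X \<longrightarrow> v x = 0" by (simp add: funs_on_def)
    have "v = (\<Sum>x\<in>X. fscale (v x) (?e x))"
    proof
      fix y
      have "(\<Sum>x\<in>X. fscale (v x) (?e x)) y = (\<Sum>x\<in>X. v x * ?e x y)" by (simp add: sum_fun_apply)
      also have "\<dots> = (\<Sum>x\<in>X. if x = y then v y else 0)" by (rule sum.cong) auto
      also have "\<dots> = v y" using assms v by simp
      finally show "v y = (\<Sum>x\<in>X. fscale (v x) (?e x)) y" by simp
    qed
    also have "\<dots> \<in> fs.span (?e ` X)"
      by (intro fs.span_sum fs.span_scale fs.span_base) auto
    finally show "v \<in> fs.span (?e ` X)" .
  qed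
qed

lemma dim_supported_le:
  assumes "finite X" "V \<subseteq> funs_on X"
  shows "fs.dim V \<le> card X"
proof -
  obtain B :: "('a \<Rightarrow> rat) set"
    where B: "finite B" "card B \<le> card X" "funs_on X \<subseteq> fs.span B"
    using span_supported[OF assms(1)] .
  have "V \<subseteq> fs.span B" using B(3) assms(2) by blast
  then show ?thesis using fs.dim_le_card[OF _ B(1)] B(2) by (meson order_trans)
qed

lemma dim_mono_supported:
  assumes "finite X" "V \<subseteq> funs_on X" "W \<subseteq> V"
  shows "fs.dim W \<le> fs.dim V"
proof -
  obtain B :: "('a \<Rightarrow> rat) set"
    where B: "finite B" "card B \<le> card X" "funs_on X \<subseteq> fs.span B"
    using span_supported[OF assms(1)] .
  obtain C where C: "C \<subseteq> V" "fs.independent C" "V \<subseteq> fs.span C" "card C = fs.dim V"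
    by (rule fs.basis_exists)
  have "C \<subseteq> fs.span B" using B(3) assms(2) C(1) by blast
  then have "finite C" using fs.independent_span_bound[OF B(1) C(2)] by blast
  moreover have "W \<subseteq> fs.span C" using assms(3) C(3) by blast
  ultimately show ?thesis using fs.dim_le_card C(4) by metis
qed

text \<open>A common finite support replaces finite-dimensionality: the type of all functions may
  itself be infinite-dimensional.\<close>

lemma rank_nullity_supported:
  assumes "finite X" "V \<subseteq> funs_on X" "fs.subspace V" "flinear f"
  shows "fs.dim V = fs.dim (f ` V) + fs.dim {v \<in> V. f v = 0}"
proof -
  obtain B :: "('a \<Rightarrow> rat) set"
    where B: "finite B" "card B \<le> card X" "funs_on X \<subseteq> fs.span B"
    using span_supported[OF assms(1)] .
  have "V \<subseteq> fs.span B" using B(3) assms(2) by blast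
  then show ?thesis using dim_image_plus_kernel[OF assms(4,3) B(1)] by blast
qed

section \<open>The square-free algebra of a simplicial complex\<close>

text \<open>\<open>v\<close> stands for the element of Phi with coefficient \<open>v S\<close> at
  phi_S. Overlapping faces multiply to 0, so the coefficient at \<open>S\<close> collects the
  splittings of \<open>S\<close> into two disjoint pieces.\<close>

definition conv :: "('a set \<Rightarrow> bool) \<Rightarrow> ('a set \<Rightarrow> rat) \<Rightarrow> ('a set \<Rightarrow> rat) \<Rightarrow> 'a set \<Rightarrow> rat" where
  "conv \<Delta> v w S = (if \<Delta> S then \<Sum>T\<in>Pow S. v T * w (S - T) else 0)"

definition unit_fn :: "'a set \<Rightarrow> rat" where
  "unit_fn S = (if S = {} then 1 else 0)"

text \<open>The element sum_e c_e phi_e; on a singleton, \<open>sum c S\<close> is the coefficient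
  of its only member.\<close>

definition lin_fn :: "('a \<Rightarrow> rat) \<Rightarrow> 'a set \<Rightarrow> rat" where
  "lin_fn c S = (if card S = 1 then sum c S else 0)"

lemma lin_fn_singleton [simp]: "lin_fn c {x} = c x"
  by (simp add: lin_fn_def)

lemma conv_add_left: "conv \<Delta> (v + v') w = conv \<Delta> v w + conv \<Delta> v' w"
  by (auto simp: fun_eq_iff conv_def algebra_simps sum.distrib)

lemma conv_scale_left: "conv \<Delta> (fscale q v) w = fscale q (conv \<Delta> v w)"
  by (auto simp: fun_eq_iff conv_def sum_distrib_left algebra_simps)

lemma conv_commute: "conv \<Delta> v w = conv \<Delta> w v"
proof
  fix S
  have "(\<Sum>T\<in>Pow S. v T * w (S - T)) = (\<Sum>T\<in>Pow S. w T * v (S - T))"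
    by (rule sum.reindex_bij_witness[where i = "\<lambda>T. S - T" and j = "\<lambda>T. S - T"])
       (auto simp: double_diff)
  then show "conv \<Delta> v w S = conv \<Delta> w v S" by (simp add: conv_def)
qed

lemma conv_add_right: "conv \<Delta> v (w + w') = conv \<Delta> v w + conv \<Delta> v w'"
  using conv_add_left conv_commute by metis

lemma conv_scale_right: "conv \<Delta> v (fscale q w) = fscale q (conv \<Delta> v w)"
  using conv_scale_left conv_commute by metis

lemma flinear_conv: "flinear (conv \<Delta> v)"
  by (rule flinearI) (simp_all add: conv_add_right conv_scale_right)

lemma conv_zero_right [simp]: "conv \<Delta> v 0 = 0"
  by (auto simp: fun_eq_iff conv_def)

text \<open>Both sides sum over the ordered partitions of \<open>S\<close> into three blocks; as
  \<open>\<Delta>\<close> is closed under subsets, the cutoff in the inner product deletes none of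
  them.\<close>

lemma conv_assoc:
  assumes "\<And>S T. \<Delta> S \<Longrightarrow> T \<subseteq> S \<Longrightarrow> \<Delta> T" "\<And>S. \<Delta> S \<Longrightarrow> finite S"
  shows "conv \<Delta> (conv \<Delta> u v) w = conv \<Delta> u (conv \<Delta> v w)"
proof
  fix S
  show "conv \<Delta> (conv \<Delta> u v) w S = conv \<Delta> u (conv \<Delta> v w) S"
  proof (cases "\<Delta> S")
    case True
    then have fin: "finite S" using assms(2) by blast
    have "conv \<Delta> (conv \<Delta> u v) w S = (\<Sum>T\<in>Pow S. \<Sum>U\<in>Pow T. u U * v (T - U) * w (S - T))"
      unfolding conv_def using True assms(1) by (auto simp: sum_distrib_right intro!: sum.cong)
    also have "\<dots> = (\<Sum>(T,U)\<in>Sigma (Pow S) Pow. u U * v (T - U) * w (S - T))"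
      using fin by (subst sum.Sigma) (auto intro: finite_subset)
    also have "\<dots> = (\<Sum>(U,W)\<in>Sigma (Pow S) (\<lambda>U. Pow (S - U)). u U * (v W * w (S - U - W)))"
      by (rule sum.reindex_bij_witness[where i = "\<lambda>(U,W). (U \<union> W, U)" and j = "\<lambda>(T,U). (U, T - U)"])
         (auto intro!: arg_cong[where f = w] arg_cong[where f = v])
    also have "\<dots> = (\<Sum>U\<in>Pow S. \<Sum>W\<in>Pow (S - U). u U * (v W * w (S - U - W)))"
      using fin by (subst sum.Sigma) (auto intro: finite_subset)
    also have "\<dots> = conv \<Delta> u (conv \<Delta> v w) S"
      unfolding conv_def using True assms(1) by (auto simp: sum_distrib_left intro!: sum.cong)
    finally show ?thesis .
  qed (simp add: conv_def)
qed

lemma conv_unit: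
  assumes "\<And>S. \<Delta> S \<Longrightarrow> finite S" "\<And>S. v S \<noteq> 0 \<Longrightarrow> \<Delta> S"
  shows "conv \<Delta> unit_fn v = v"
proof
  fix S
  have "(\<Sum>T\<in>Pow S. unit_fn T * v (S - T)) = (\<Sum>T\<in>{{}}. unit_fn T * v (S - T))" if "\<Delta> S"
    using assms(1)[OF that] by (intro sum.mono_neutral_right) (auto simp: unit_fn_def)
  then show "conv \<Delta> unit_fn v S = v S" using assms(2) by (auto simp: conv_def unit_fn_def)
qed

lemma conv_lin:
  assumes "\<Delta> S" "finite S"
  shows "conv \<Delta> (lin_fn c) v S = (\<Sum>x\<in>S. c x * v (S - {x}))"
proof -
  have "(\<Sum>T\<in>Pow S. lin_fn c T * v (S - T)) = (\<Sum>T\<in>(\<lambda>x. {x}) ` S. lin_fn c T * v (S - T))"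
    using assms(2) by (intro sum.mono_neutral_right) (auto simp: lin_fn_def card_1_singleton_iff)
  also have "\<dots> = (\<Sum>x\<in>S. c x * v (S - {x}))" by (subst sum.reindex) (auto simp: inj_on_def)
  finally show ?thesis using assms(1) by (simp add: conv_def)
qed

lemma lin_fn_add: "lin_fn (c + c') = lin_fn c + lin_fn c'"
  by (auto simp: fun_eq_iff lin_fn_def sum.distrib)

lemma lin_fn_scale: "lin_fn (fscale q c) = fscale q (lin_fn c)"
  by (auto simp: fun_eq_iff lin_fn_def sum_distrib_left)

section \<open>The algebra of a space of relations\<close>

text \<open>
  A matroid over \<open>E\<close> is encoded by the space \<open>L\<close> of linear relations among the vectors representing
  it: a set is independent iff it supports no nonzero relation. Deleting \<open>e\<close> keeps the relations
  that vanish at \<open>e\<close>, contracting \<open>e\<close> forgets the coordinate \<open>e\<close>.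
\<close>

definition rel_indep :: "'a set \<Rightarrow> ('a \<Rightarrow> rat) set \<Rightarrow> 'a set \<Rightarrow> bool" where
  "rel_indep E L S \<longleftrightarrow> S \<subseteq> E \<and> (\<forall>c\<in>L. (\<forall>x. x \<notin> S \<longrightarrow> c x = 0) \<longrightarrow> c = 0)"

primrec rel_alg :: "'a set \<Rightarrow> ('a \<Rightarrow> rat) set \<Rightarrow> nat \<Rightarrow> ('a set \<Rightarrow> rat) set" where
  "rel_alg E L 0 = fs.span {unit_fn}"
| "rel_alg E L (Suc i) =
     fs.span {conv (rel_indep E L) (lin_fn c) v | c v. c \<in> L \<and> v \<in> rel_alg E L i}"

text \<open>If \<open>L\<close> consists of the relations among vectors b_x, the \<open>l\<close>
  orthogonal to \<open>L\<close> are the maps sending x to lambda(b_x) for linear functionals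
  lambda. This is then the balancing condition of Minkowski weights: at every \<open>T\<close>, the
  sum of \<open>v (insert x T)\<close> times b_x over \<open>x\<close> in \<open>E - T\<close> lies
  in the span of the vectors of \<open>T\<close>.\<close>

definition balanced :: "'a set \<Rightarrow> ('a \<Rightarrow> rat) set \<Rightarrow> nat \<Rightarrow> ('a set \<Rightarrow> rat) set" where
  "balanced E L i = {v. (\<forall>S. v S \<noteq> 0 \<longrightarrow> rel_indep E L S \<and> card S = i) \<and>
     (\<forall>T l. (\<forall>c\<in>L. (\<Sum>x\<in>E. l x * c x) = 0) \<longrightarrow> (\<forall>x\<in>T. l x = 0) \<longrightarrow>
        (\<Sum>x\<in>E - T. l x * v (insert x T)) = 0)}"

lemma balancedD:
  assumes "v \<in> balanced E L i" "\<And>c. c \<in> L \<Longrightarrow> (\<Sum>x\<in>E. l x * c x) = 0" "\<And>x. x \<in> T \<Longrightarrow> l x = 0"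
  shows "(\<Sum>x\<in>E - T. l x * v (insert x T)) = 0"
  using assms unfolding balanced_def by blast

lemma balanced_supp: "v \<in> balanced E L i \<Longrightarrow> v S \<noteq> 0 \<Longrightarrow> rel_indep E L S \<and> card S = i"
  unfolding balanced_def by blast

definition rel_del :: "('a \<Rightarrow> rat) set \<Rightarrow> 'a \<Rightarrow> ('a \<Rightarrow> rat) set" where
  "rel_del L e = {c \<in> L. c e = 0}"

definition rel_con :: "('a \<Rightarrow> rat) set \<Rightarrow> 'a \<Rightarrow> ('a \<Rightarrow> rat) set" where
  "rel_con L e = (\<lambda>c. c(e := 0)) ` L"

lemma subspace_balanced: "fs.subspace (balanced E L i)"
proof (rule fs.subspaceI)
  show "0 \<in> balanced E L i" by (auto simp: balanced_def)
next
  fix v w assume v: "v \<in> balanced E L i" and w: "w \<in> balanced E L i"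
  show "v + w \<in> balanced E L i"
    unfolding balanced_def
  proof (intro CollectI conjI allI impI)
    fix T l assume "\<forall>c\<in>L. (\<Sum>x\<in>E. l x * c x) = 0" "\<forall>x\<in>T. l x = 0"
    then show "(\<Sum>x\<in>E - T. l x * (v + w) (insert x T)) = 0"
      using balancedD[OF v, of l T] balancedD[OF w, of l T] by (simp add: algebra_simps sum.distrib)
  next
    fix S assume "(v + w) S \<noteq> 0"
    then have "v S \<noteq> 0 \<or> w S \<noteq> 0" by auto
    then show "rel_indep E L S" "card S = i"
      using balanced_supp[OF v, of S] balanced_supp[OF w, of S] by auto
  qed
next
  fix q v assume v: "v \<in> balanced E L i"
  show "fscale q v \<in> balanced E L i"
    unfolding balanced_def
  proof (intro CollectI conjI allI impI)
    fix T l assume "\<forall>c\<in>L. (\<Sum>x\<in>E. l x * c x) = 0" "\<forall>x\<in>T. l x = 0"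
    then have "q * (\<Sum>x\<in>E - T. l x * v (insert x T)) = 0" using balancedD[OF v, of l T] by simp
    then show "(\<Sum>x\<in>E - T. l x * fscale q v (insert x T)) = 0"
      by (simp only: sum_distrib_left fscale_apply mult.left_commute)
  next
    fix S assume "fscale q v S \<noteq> 0"
    then show "rel_indep E L S" "card S = i"
      using balanced_supp[OF v, of S] by auto
  qed
qed

lemma subspace_rel_alg: "fs.subspace (rel_alg E L i)"
  by (cases i) auto

locale relation_space =
  fixes E :: "'a set" and L :: "('a \<Rightarrow> rat) set"
  assumes finite_E: "finite E"
    and subspace_L: "fs.subspace L"
    and supported: "c \<in> L \<Longrightarrow> x \<notin> E \<Longrightarrow> c x = 0"
begin

abbreviation "ind \<equiv> rel_indep E L"
abbreviation "mul \<equiv> conv ind"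

lemma ind_finite: "ind S \<Longrightarrow> finite S"
  using finite_E finite_subset unfolding rel_indep_def by blast

lemma ind_subset: "ind S \<Longrightarrow> T \<subseteq> S \<Longrightarrow> ind T"
  unfolding rel_indep_def by blast

lemma ind_empty: "ind {}"
  unfolding rel_indep_def by (auto simp: fun_eq_iff)

lemma mul_assoc: "mul (mul u v) w = mul u (mul v w)"
  by (rule conv_assoc) (auto intro: ind_finite ind_subset)

lemma mul_left_commute: "mul u (mul v w) = mul v (mul u w)"
  by (metis mul_assoc conv_commute)

lemma mul_lin: "mul (lin_fn c) v S = (if ind S then \<Sum>x\<in>S. c x * v (S - {x}) else 0)"
  using conv_lin[of ind S c v] ind_finite by (auto simp: conv_def)

text \<open>In the balancing sum at \<open>T\<close>, each term of the product removes one element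
  of \<open>insert f T\<close>. Removing \<open>f\<close> leaves \<open>v T\<close> times the
  pairing of \<open>l\<close> with \<open>c\<close>, which is 0 by orthogonality; removing
  \<open>g\<close> in \<open>T\<close> leaves a balancing sum of \<open>v\<close> at
  \<open>T - {g}\<close>.\<close>

lemma mul_lin_balanced:
  assumes c: "c \<in> L" and v: "v \<in> balanced E L i"
  shows "mul (lin_fn c) v \<in> balanced E L (Suc i)"
  unfolding balanced_def
proof (intro CollectI conjI allI impI)
  fix S assume "mul (lin_fn c) v S \<noteq> 0"
  then have S: "ind S" "(\<Sum>x\<in>S. c x * v (S - {x})) \<noteq> 0"
    by (auto simp: mul_lin split: if_splits)
  obtain x where "x \<in> S" "c x * v (S - {x}) \<noteq> 0"
    by (rule sum.not_neutral_contains_not_neutral[OF S(2)])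
  then have x: "x \<in> S" "v (S - {x}) \<noteq> 0" by auto
  show "ind S" by fact
  have "card (S - {x}) = i" using balanced_supp[OF v x(2)] by simp
  then show "card S = Suc i" using x(1) ind_finite[OF S(1)] by (metis card_Suc_Diff1)
next
  fix T l assume l: "\<forall>c\<in>L. (\<Sum>x\<in>E. l x * c x) = 0" and lT: "\<forall>x\<in>T. l x = 0"
  show "(\<Sum>x\<in>E - T. l x * mul (lin_fn c) v (insert x T)) = 0"
  proof (cases "ind T")
    case False
    then have "\<not> ind (insert x T)" for x using ind_subset by (meson subset_insertI)
    then show ?thesis by (simp add: mul_lin)
  next
    case True
    have finT: "finite T" using True ind_finite by blast
    have TE: "T \<subseteq> E" using True unfolding rel_indep_def by blast
    \<comment> \<open>A functional vanishing on \<open>T\<close> but not at \<open>f\<close>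
      certifies independence: in its pairing with a relation supported on \<open>insert f T\<close>,
      only the term at \<open>f\<close> survives. So no term with \<open>l f \<noteq> 0\<close> is
      lost to the cutoff in the product.\<close>
    have ins: "ind (insert f T)" if f: "f \<in> E - T" "l f \<noteq> 0" for f
      unfolding rel_indep_def
    proof (intro conjI ballI impI)
      show "insert f T \<subseteq> E" using f TE by auto
      fix a assume a: "a \<in> L" "\<forall>x. x \<notin> insert f T \<longrightarrow> a x = 0"
      have "(\<Sum>x\<in>E. l x * a x) = (\<Sum>x\<in>{f}. l x * a x)"
        using f a(2) lT finite_E by (intro sum.mono_neutral_right) auto
      then have "a f = 0" using l a(1) f(2) by simp
      then have "\<forall>x. x \<notin> T \<longrightarrow> a x = 0" using a(2) by auto
      then show "a = 0" using True a(1) unfolding rel_indep_def by blast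
    qed
    have "(\<Sum>x\<in>E - T. l x * mul (lin_fn c) v (insert x T)) =
        (\<Sum>f\<in>E - T. l f * (c f * v T) + (\<Sum>g\<in>T. c g * (l f * v (insert f (T - {g})))))"
    proof (rule sum.cong[OF refl])
      fix f assume f: "f \<in> E - T"
      show "l f * mul (lin_fn c) v (insert f T) =
        l f * (c f * v T) + (\<Sum>g\<in>T. c g * (l f * v (insert f (T - {g}))))"
      proof (cases "l f = 0")
        case False
        then have "mul (lin_fn c) v (insert f T) = (\<Sum>x\<in>insert f T. c x * v (insert f T - {x}))"
          using ins f by (simp add: mul_lin)
        also have "\<dots> = c f * v T + (\<Sum>g\<in>T. c g * v (insert f T - {g}))"
          using f finT by (simp add: insert_Diff_if)
        also have "(\<Sum>g\<in>T. c g * v (insert f T - {g})) = (\<Sum>g\<in>T. c g * v (insert f (T - {g})))"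
          using f by (intro sum.cong) (auto simp: insert_Diff_if)
        finally show ?thesis by (simp add: algebra_simps sum_distrib_left)
      qed simp
    qed
    also have "\<dots> = v T * (\<Sum>f\<in>E - T. l f * c f) +
        (\<Sum>g\<in>T. c g * (\<Sum>f\<in>E - T. l f * v (insert f (T - {g}))))"
    proof -
      have "(\<Sum>f\<in>E - T. \<Sum>g\<in>T. c g * (l f * v (insert f (T - {g})))) =
          (\<Sum>g\<in>T. \<Sum>f\<in>E - T. c g * (l f * v (insert f (T - {g}))))" by (rule sum.swap)
      then show ?thesis by (simp add: sum.distrib sum_distrib_left mult_ac)
    qed
    also have "(\<Sum>f\<in>E - T. l f * c f) = (\<Sum>f\<in>E. l f * c f)"
      using lT finite_E by (intro sum.mono_neutral_left) auto
    also have "\<dots> = 0" using l c by blast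
    also have "(\<Sum>g\<in>T. c g * (\<Sum>f\<in>E - T. l f * v (insert f (T - {g})))) = 0"
    proof (intro sum.neutral ballI)
      fix g assume g: "g \<in> T"
      \<comment> \<open>The index \<open>g\<close> can be added because
        \<open>l g = 0\<close>.\<close>
      have "(\<Sum>f\<in>E - T. l f * v (insert f (T - {g}))) =
          (\<Sum>f\<in>E - (T - {g}). l f * v (insert f (T - {g})))"
        using g lT finite_E by (intro sum.mono_neutral_left) auto
      also have "\<dots> = 0" using balancedD[OF v, of l "T - {g}"] l lT by blast
      finally show "c g * (\<Sum>f\<in>E - T. l f * v (insert f (T - {g}))) = 0" by simp
    qed
    finally show ?thesis by simp
  qed
qed

lemma rel_alg_balanced: "rel_alg E L i \<subseteq> balanced E L i"
proof (induction i)
  case 0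
  have "unit_fn \<in> balanced E L 0"
    by (auto simp: balanced_def unit_fn_def ind_empty)
  then show ?case by (simp add: fs.span_minimal subspace_balanced)
next
  case (Suc i)
  have "{mul (lin_fn c) v |c v. c \<in> L \<and> v \<in> rel_alg E L i} \<subseteq> balanced E L (Suc i)"
    using Suc mul_lin_balanced by blast
  then show ?case unfolding rel_alg.simps by (rule fs.span_minimal[OF _ subspace_balanced])
qed

lemma rel_alg_supp: "v \<in> rel_alg E L i \<Longrightarrow> v S \<noteq> 0 \<Longrightarrow> ind S \<and> card S = i"
  using rel_alg_balanced balanced_supp by blast

lemma mul_lin_rel_alg: "c \<in> L \<Longrightarrow> v \<in> rel_alg E L i \<Longrightarrow> mul (lin_fn c) v \<in> rel_alg E L (Suc i)"
  by (auto intro!: fs.span_base)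

end

section \<open>Deletion and contraction\<close>

text \<open>If an element of Phi is written v0 + phi_e v1 with v0 and v1 free of phi_e, this is v1,
  the partial derivative in phi_e.\<close>

definition link_fn :: "'a \<Rightarrow> ('a set \<Rightarrow> rat) \<Rightarrow> 'a set \<Rightarrow> rat" where
  "link_fn e v S = (if e \<in> S then 0 else v (insert e S))"

text \<open>Sets phi_e to 0 and discards the faces outside the link of \<open>e\<close>; for
  independent \<open>{e}\<close> this link is the complex of the contraction.\<close>

definition res_fn :: "('a set \<Rightarrow> bool) \<Rightarrow> 'a \<Rightarrow> ('a set \<Rightarrow> rat) \<Rightarrow> 'a set \<Rightarrow> rat" where
  "res_fn \<Delta> e v S = (if e \<notin> S \<and> \<Delta> (insert e S) then v S else 0)"

lemma flinear_link_fn: "flinear (link_fn e)"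
  by (rule flinearI) (auto simp: link_fn_def fun_eq_iff)

lemma flinear_res_fn: "flinear (res_fn \<Delta> e)"
  by (rule flinearI) (auto simp: res_fn_def fun_eq_iff)

lemma flinear_subspace_image: "flinear f \<Longrightarrow> fs.subspace V \<Longrightarrow> fs.subspace (f ` V)"
  using Modules.module_hom.subspace_image Vector_Spaces.linear.axioms(3) by blast

lemma flinear_subspace_preimage: "flinear f \<Longrightarrow> fs.subspace V \<Longrightarrow> fs.subspace {v. f v \<in> V}"
  using Modules.module_hom.subspace_linear_preimage Vector_Spaces.linear.axioms(3) by blast

lemma flinear_add: "flinear f \<Longrightarrow> f (v + w) = f v + f w"
  by (simp add: Vector_Spaces.linear_iff)

lemma flinear_scale: "flinear f \<Longrightarrow> f (fscale q v) = fscale q (f v)"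
  by (simp add: Vector_Spaces.linear_iff)

lemma flinear_span_image: "flinear f \<Longrightarrow> f ` fs.span B = fs.span (f ` B)"
  using Modules.module_hom.span_image[OF Vector_Spaces.linear.axioms(3)] by (rule sym)

lemma flinear_zero: "flinear f \<Longrightarrow> f 0 = 0"
  using flinear_scale[of f 0 0] by (simp add: fun_eq_iff)

lemma dim_span_singleton: "v \<noteq> 0 \<Longrightarrow> fs.dim (fs.span {v}) = 1"
  by (subst fs.dim_span_eq_card_independent) auto

context relation_space
begin

lemma rel_alg_outside: "rel_alg E L i \<subseteq> funs_on (Pow E)"
  using rel_alg_supp unfolding rel_indep_def funs_on_def by blast

lemma balanced_outside: "balanced E L i \<subseteq> funs_on (Pow E)"
  using balanced_supp unfolding rel_indep_def funs_on_def by blast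

lemma finite_Pow_E: "finite (Pow E)"
  using finite_E by simp

lemma dim_rel_alg_0: "fs.dim (rel_alg E L 0) = 1"
proof -
  have "unit_fn \<noteq> (0 :: 'a set \<Rightarrow> rat)" by (auto simp: unit_fn_def fun_eq_iff)
  then show ?thesis unfolding rel_alg.simps by (rule dim_span_singleton)
qed

lemma dim_balanced_0: "fs.dim (balanced E L 0) = 1"
proof (rule antisym)
  have "v S = 0" if "v \<in> balanced E L 0" "S \<notin> {{}}" for v S
    using balanced_supp[OF that(1), of S] that(2) ind_finite by auto
  then show "fs.dim (balanced E L 0) \<le> 1"
    using dim_supported_le[of "{{}}" "balanced E L 0"] by (auto simp: funs_on_def)
  show "1 \<le> fs.dim (balanced E L 0)"
    using dim_mono_supported[OF finite_Pow_E balanced_outside rel_alg_balanced] dim_rel_alg_0 by metis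
qed

lemma dim_rel_alg_le_balanced: "fs.dim (rel_alg E L i) \<le> fs.dim (balanced E L i)"
  by (rule dim_mono_supported[OF finite_Pow_E balanced_outside rel_alg_balanced])

lemma relation_space_del: "relation_space (E - {e}) (rel_del L e)"
proof
  show "finite (E - {e})" using finite_E by simp
  show "fs.subspace (rel_del L e)"
    using subspace_L unfolding rel_del_def fs.subspace_def by auto
  show "c x = 0" if "c \<in> rel_del L e" "x \<notin> E - {e}" for c x
    using that supported unfolding rel_del_def by auto
qed

lemma flinear_upd: "flinear (\<lambda>c. c(e := 0))"
  by (rule flinearI) (auto simp: fun_eq_iff)

lemma relation_space_con: "relation_space (E - {e}) (rel_con L e)"
proof
  show "finite (E - {e})" using finite_E by simp
  show "fs.subspace (rel_con L e)"
    unfolding rel_con_def by (rule flinear_subspace_image[OF flinear_upd subspace_L])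
  show "c x = 0" if "c \<in> rel_con L e" "x \<notin> E - {e}" for c x
    using that supported unfolding rel_con_def by auto
qed

lemma ind_del: "rel_indep (E - {e}) (rel_del L e) S \<longleftrightarrow> ind S \<and> e \<notin> S"
  unfolding rel_indep_def rel_del_def by auto

text \<open>Relations of the contraction supported on \<open>S\<close> come from relations in
  \<open>L\<close> supported on \<open>insert e S\<close>. Independence of \<open>{e}\<close>
  guarantees that forgetting \<open>e\<close> turns no nonzero relation into 0.\<close>

lemma ind_con:
  assumes e: "ind {e}"
  shows "rel_indep (E - {e}) (rel_con L e) S \<longleftrightarrow> e \<notin> S \<and> ind (insert e S)"
proof
  assume S: "rel_indep (E - {e}) (rel_con L e) S"
  then have S': "S \<subseteq> E" "e \<notin> S" unfolding rel_indep_def by auto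
  have "ind (insert e S)" unfolding rel_indep_def
  proof (intro conjI ballI impI)
    show "insert e S \<subseteq> E" using S' e unfolding rel_indep_def by auto
    fix c assume c: "c \<in> L" "\<forall>x. x \<notin> insert e S \<longrightarrow> c x = 0"
    then have "c(e := 0) \<in> rel_con L e" "\<forall>x. x \<notin> S \<longrightarrow> (c(e := 0)) x = 0"
      by (auto simp: rel_con_def)
    then have "c(e := 0) = 0" using S unfolding rel_indep_def by blast
    then have "\<forall>x. x \<notin> {e} \<longrightarrow> c x = 0" by (metis fun_upd_apply singletonI zero_fun_apply)
    then show "c = 0" using e c(1) unfolding rel_indep_def by blast
  qed
  then show "e \<notin> S \<and> ind (insert e S)" using S' by blast
next
  assume S: "e \<notin> S \<and> ind (insert e S)"
  show "rel_indep (E - {e}) (rel_con L e) S" unfolding rel_indep_def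
  proof (intro conjI ballI impI)
    show "S \<subseteq> E - {e}" using S unfolding rel_indep_def by auto
    fix c assume c: "c \<in> rel_con L e" "\<forall>x. x \<notin> S \<longrightarrow> c x = 0"
    then obtain a where a: "a \<in> L" "c = a(e := 0)" by (auto simp: rel_con_def)
    then have "\<forall>x. x \<notin> insert e S \<longrightarrow> a x = 0" using c(2) by auto
    then have "a = 0" using a(1) S unfolding rel_indep_def by blast
    then show "c = 0" using a(2) by (auto simp: fun_eq_iff)
  qed
qed

text \<open>Neither factor involves \<open>e\<close>, so the product vanishes at the sets containing
  \<open>e\<close>, and the deletion can be computed inside the original algebra.\<close>

lemma mul_lin_del:
  assumes "c \<in> rel_del L e" "\<And>S. e \<in> S \<Longrightarrow> v S = 0"
  shows "conv (rel_indep (E - {e}) (rel_del L e)) (lin_fn c) v = mul (lin_fn c) v"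
proof
  fix S
  interpret D: relation_space "E - {e}" "rel_del L e" by (rule relation_space_del)
  have "(\<Sum>x\<in>S. c x * v (S - {x})) = 0" if "e \<in> S"
  proof (intro sum.neutral ballI)
    fix x assume "x \<in> S"
    show "c x * v (S - {x}) = 0"
      using assms that unfolding rel_del_def by (cases "x = e") auto
  qed
  then show "conv (rel_indep (E - {e}) (rel_del L e)) (lin_fn c) v S = mul (lin_fn c) v S"
    by (auto simp: mul_lin D.mul_lin ind_del)
qed

lemma rel_alg_del_vanish: "v \<in> rel_alg (E - {e}) (rel_del L e) i \<Longrightarrow> e \<in> S \<Longrightarrow> v S = 0"
  using relation_space.rel_alg_supp[OF relation_space_del] ind_del by blast

lemma rel_alg_del_subset: "rel_alg (E - {e}) (rel_del L e) i \<subseteq> rel_alg E L i"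
proof (induction i)
  case (Suc i)
  have "conv (rel_indep (E - {e}) (rel_del L e)) (lin_fn c) v \<in> rel_alg E L (Suc i)"
    if "c \<in> rel_del L e" "v \<in> rel_alg (E - {e}) (rel_del L e) i" for c v
  proof -
    have "mul (lin_fn c) v \<in> rel_alg E L (Suc i)"
      using that Suc unfolding rel_del_def by (intro mul_lin_rel_alg) auto
    then show ?thesis using mul_lin_del[OF that(1) rel_alg_del_vanish[OF that(2)]] by simp
  qed
  then show ?case
    by (subst rel_alg.simps(2), intro fs.span_minimal subspace_rel_alg) blast
qed simp

section \<open>Balanced weights under contraction and deletion: the upper bound\<close>

text \<open>A functional of the contraction, reset to 0 at \<open>e\<close>, is orthogonal to
  \<open>L\<close>; balancing the link at \<open>T\<close> is balancing \<open>v\<close> at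
  \<open>insert e T\<close>.\<close>

lemma balanced_link:
  assumes e: "ind {e}" and v: "v \<in> balanced E L (Suc i)"
  shows "link_fn e v \<in> balanced (E - {e}) (rel_con L e) i"
  unfolding balanced_def
proof (intro CollectI conjI allI impI)
  fix S assume "link_fn e v S \<noteq> 0"
  then have S: "e \<notin> S" "v (insert e S) \<noteq> 0" by (auto simp: link_fn_def split: if_splits)
  from balanced_supp[OF v S(2)] have c: "ind (insert e S)" "card (insert e S) = Suc i" by auto
  show "rel_indep (E - {e}) (rel_con L e) S" using c S ind_con[OF e] by blast
  show "card S = i" using c S(1) ind_finite[OF c(1)] by simp
next
  fix T l assume l: "\<forall>c\<in>rel_con L e. (\<Sum>x\<in>E - {e}. l x * c x) = 0" "\<forall>x\<in>T. l x = 0"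
  show "(\<Sum>x\<in>E - {e} - T. l x * link_fn e v (insert x T)) = 0"
  proof (cases "e \<in> T")
    case False
    let ?l = "l(e := 0)"
    have "(\<Sum>x\<in>E. ?l x * c x) = 0" if "c \<in> L" for c
    proof -
      have "(\<Sum>x\<in>E. ?l x * c x) = (\<Sum>x\<in>E - {e}. ?l x * c x)"
        using finite_E by (intro sum.mono_neutral_right) auto
      also have "\<dots> = (\<Sum>x\<in>E - {e}. l x * (c(e := 0)) x)" by (rule sum.cong) auto
      also have "\<dots> = 0" using l(1) that unfolding rel_con_def by blast
      finally show ?thesis .
    qed
    then have "(\<Sum>x\<in>E - insert e T. ?l x * v (insert x (insert e T))) = 0"
      by (rule balancedD[OF v]) (use l(2) in auto)
    also have "(\<Sum>x\<in>E - insert e T. ?l x * v (insert x (insert e T))) =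
        (\<Sum>x\<in>E - {e} - T. l x * link_fn e v (insert x T))"
      using False by (intro sum.cong) (auto simp: link_fn_def insert_commute)
    finally show ?thesis .
  qed (simp add: link_fn_def)
qed

text \<open>Every functional orthogonal to \<open>rel_del L e\<close> extends to one orthogonal to
  \<open>L\<close>. Its value at \<open>e\<close> is multiplied only by coefficients of
  \<open>v\<close> at sets containing \<open>e\<close>, which are 0.\<close>

lemma balanced_del:
  assumes e: "e \<in> E" and v: "v \<in> balanced E L i" and z: "link_fn e v = 0"
  shows "v \<in> balanced (E - {e}) (rel_del L e) i"
proof -
  have van: "v S = 0" if "e \<in> S" for S
  proof -
    have "link_fn e v (S - {e}) = 0" using z by simp
    then show ?thesis using that by (simp add: link_fn_def insert_absorb)
  qed
  show ?thesis
    unfolding balanced_def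
  proof (intro CollectI conjI allI impI)
    fix S assume S: "v S \<noteq> 0"
    then show "rel_indep (E - {e}) (rel_del L e) S" "card S = i"
      using balanced_supp[OF v S] van ind_del by blast+
  next
    fix T l assume l: "\<forall>c\<in>rel_del L e. (\<Sum>x\<in>E - {e}. l x * c x) = 0" "\<forall>x\<in>T. l x = 0"
    show "(\<Sum>x\<in>E - {e} - T. l x * v (insert x T)) = 0"
    proof (cases "e \<in> T")
      case True
      then show ?thesis using van by simp
    next
      case False
      have "\<exists>s. \<forall>c\<in>L. (\<Sum>x\<in>E - {e}. l x * c x) + s * c e = 0"
      proof (cases "\<exists>u\<in>L. u e \<noteq> 0")
        case False
        then have "\<forall>c\<in>L. (\<Sum>x\<in>E - {e}. l x * c x) + 0 * c e = 0"
          using l(1) unfolding rel_del_def by auto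
        then show ?thesis by blast
      next
        case True
        then obtain u where u: "u \<in> L" "u e \<noteq> 0" by blast
        \<comment> \<open>Forced by orthogonality to \<open>u\<close>. It serves all of
          \<open>L\<close>, because \<open>c\<close> minus \<open>c e / u e\<close> times
          \<open>u\<close> lies in \<open>rel_del L e\<close>.\<close>
        let ?s = "- (\<Sum>x\<in>E - {e}. l x * u x) / u e"
        have "(\<Sum>x\<in>E - {e}. l x * c x) + ?s * c e = 0" if c: "c \<in> L" for c
        proof -
          have "c - fscale (c e / u e) u \<in> rel_del L e"
            using c u subspace_L unfolding rel_del_def
            by (auto intro!: fs.subspace_diff fs.subspace_scale)
          then have "0 = (\<Sum>x\<in>E - {e}. l x * (c - fscale (c e / u e) u) x)" using l(1) by metis
          also have "\<dots> = (\<Sum>x\<in>E - {e}. l x * c x) - (\<Sum>x\<in>E - {e}. (c e / u e) * (l x * u x))"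
            unfolding sum_subtractf[symmetric] by (rule sum.cong) (auto simp: algebra_simps)
          also have "(\<Sum>x\<in>E - {e}. (c e / u e) * (l x * u x)) = (c e / u e) * (\<Sum>x\<in>E - {e}. l x * u x)"
            by (rule sum_distrib_left[symmetric])
          finally show ?thesis by simp
        qed
        then show ?thesis by blast
      qed
      then obtain s where s: "\<And>c. c \<in> L \<Longrightarrow> (\<Sum>x\<in>E - {e}. l x * c x) + s * c e = 0" by blast
      let ?l = "l(e := s)"
      have "(\<Sum>x\<in>E. ?l x * c x) = 0" if "c \<in> L" for c
      proof -
        have "(\<Sum>x\<in>E. ?l x * c x) = s * c e + (\<Sum>x\<in>E - {e}. ?l x * c x)"
          using finite_E e by (subst sum.remove[of _ e]) auto
        also have "(\<Sum>x\<in>E - {e}. ?l x * c x) = (\<Sum>x\<in>E - {e}. l x * c x)" by (rule sum.cong) auto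
        finally show ?thesis using s[OF that] by simp
      qed
      moreover have "\<And>x. x \<in> T \<Longrightarrow> ?l x = 0" using l(2) False by auto
      ultimately have "(\<Sum>x\<in>E - T. ?l x * v (insert x T)) = 0" by (rule balancedD[OF v])
      also have "(\<Sum>x\<in>E - T. ?l x * v (insert x T)) = (\<Sum>x\<in>E - {e} - T. ?l x * v (insert x T))"
        using finite_E van by (intro sum.mono_neutral_right) auto
      also have "\<dots> = (\<Sum>x\<in>E - {e} - T. l x * v (insert x T))" by (rule sum.cong) auto
      finally show ?thesis .
    qed
  qed
qed

lemma dim_balanced_le:
  assumes e: "ind {e}"
  shows "fs.dim (balanced E L (Suc i)) \<le>
    fs.dim (balanced (E - {e}) (rel_con L e) i) + fs.dim (balanced (E - {e}) (rel_del L e) (Suc i))"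
proof -
  interpret C: relation_space "E - {e}" "rel_con L e" by (rule relation_space_con)
  interpret D: relation_space "E - {e}" "rel_del L e" by (rule relation_space_del)
  have "e \<in> E" using e unfolding rel_indep_def by auto
  have "fs.dim (balanced E L (Suc i)) = fs.dim (link_fn e ` balanced E L (Suc i)) +
      fs.dim {v \<in> balanced E L (Suc i). link_fn e v = 0}"
    by (rule rank_nullity_supported[OF finite_Pow_E balanced_outside subspace_balanced flinear_link_fn])
  also have "\<dots> \<le> fs.dim (balanced (E - {e}) (rel_con L e) i) +
      fs.dim (balanced (E - {e}) (rel_del L e) (Suc i))"
  proof (rule add_mono)
    show "fs.dim (link_fn e ` balanced E L (Suc i)) \<le> fs.dim (balanced (E - {e}) (rel_con L e) i)"
      by (rule dim_mono_supported[OF C.finite_Pow_E C.balanced_outside])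
         (use balanced_link[OF e] in blast)
    show "fs.dim {v \<in> balanced E L (Suc i). link_fn e v = 0} \<le>
        fs.dim (balanced (E - {e}) (rel_del L e) (Suc i))"
      by (rule dim_mono_supported[OF D.finite_Pow_E D.balanced_outside])
         (use balanced_del[OF \<open>e \<in> E\<close>] in blast)
  qed
  finally show ?thesis .
qed

section \<open>The algebra under contraction and deletion: the lower bound\<close>

text \<open>Leibniz rule for the derivative in phi_e: the factor phi_e comes either from the linear
  form, with coefficient \<open>c e\<close>, or from \<open>y\<close>.\<close>

lemma link_mul_lin:
  assumes e: "ind {e}"
  shows "link_fn e (mul (lin_fn c) y) = fscale (c e) (res_fn ind e y) +
    conv (rel_indep (E - {e}) (rel_con L e)) (lin_fn (c(e := 0))) (link_fn e y)"
proof
  fix S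
  interpret C: relation_space "E - {e}" "rel_con L e" by (rule relation_space_con)
  show "link_fn e (mul (lin_fn c) y) S = (fscale (c e) (res_fn ind e y) +
    C.mul (lin_fn (c(e := 0))) (link_fn e y)) S"
  proof (cases "e \<notin> S \<and> ind (insert e S)")
    case False
    then show ?thesis by (auto simp: link_fn_def C.mul_lin mul_lin res_fn_def ind_con[OF e])
  next
    case True
    then have fin: "finite S" using ind_finite[of "insert e S"] by simp
    have "link_fn e (mul (lin_fn c) y) S = (\<Sum>x\<in>insert e S. c x * y (insert e S - {x}))"
      using True by (simp add: link_fn_def mul_lin)
    also have "\<dots> = c e * y S + (\<Sum>x\<in>S. c x * y (insert e S - {x}))"
      using True fin by simp
    also have "(\<Sum>x\<in>S. c x * y (insert e S - {x})) =
        (\<Sum>x\<in>S. (c(e := 0)) x * link_fn e y (S - {x}))"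
      using True by (intro sum.cong) (auto simp: link_fn_def insert_Diff_if)
    finally show ?thesis using True by (simp add: C.mul_lin res_fn_def ind_con[OF e])
  qed
qed

text \<open>Restriction to the link respects products, because the link is itself closed under
  subsets.\<close>

lemma res_mul_lin:
  assumes e: "ind {e}"
  shows "res_fn ind e (mul (lin_fn c) y) =
    conv (rel_indep (E - {e}) (rel_con L e)) (lin_fn (c(e := 0))) (res_fn ind e y)"
proof
  fix S
  interpret C: relation_space "E - {e}" "rel_con L e" by (rule relation_space_con)
  show "res_fn ind e (mul (lin_fn c) y) S = C.mul (lin_fn (c(e := 0))) (res_fn ind e y) S"
  proof (cases "e \<notin> S \<and> ind (insert e S)")
    case False
    then show ?thesis by (auto simp: res_fn_def C.mul_lin ind_con[OF e])
  next
    case True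
    then have "ind S" using ind_subset by blast
    have "ind (insert e (S - {x}))" for x using True ind_subset by (meson Diff_subset insert_mono)
    then have "(\<Sum>x\<in>S. c x * y (S - {x})) = (\<Sum>x\<in>S. (c(e := 0)) x * res_fn ind e y (S - {x}))"
      using True by (intro sum.cong) (auto simp: res_fn_def)
    then show ?thesis using True \<open>ind S\<close> by (simp add: res_fn_def C.mul_lin mul_lin ind_con[OF e])
  qed
qed

text \<open>Every relation of the contraction is one of \<open>L\<close> with \<open>e\<close>
  forgotten, so the generating products lift through the multiplicative restriction.\<close>

lemma rel_alg_con_subset:
  assumes e: "ind {e}"
  shows "rel_alg (E - {e}) (rel_con L e) i \<subseteq> res_fn ind e ` rel_alg E L i"
proof (induction i)
  case 0
  have "res_fn ind e unit_fn = unit_fn" using e by (auto simp: fun_eq_iff res_fn_def unit_fn_def)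
  then show ?case unfolding rel_alg.simps by (simp add: flinear_span_image[OF flinear_res_fn])
next
  case (Suc i)
  have "conv (rel_indep (E - {e}) (rel_con L e)) (lin_fn c) v \<in> res_fn ind e ` rel_alg E L (Suc i)"
    if c: "c \<in> rel_con L e" and v: "v \<in> rel_alg (E - {e}) (rel_con L e) i" for c v
  proof -
    obtain a where a: "a \<in> L" "c = a(e := 0)" using c unfolding rel_con_def by blast
    obtain w where w: "w \<in> rel_alg E L i" "v = res_fn ind e w" using v Suc by blast
    show ?thesis unfolding a(2) w(2) res_mul_lin[OF e, symmetric]
      using mul_lin_rel_alg[OF a(1) w(1)] by blast
  qed
  then show ?case
    by (subst rel_alg.simps(2),
        intro fs.span_minimal flinear_subspace_image[OF flinear_res_fn] subspace_rel_alg) blast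
qed

lemma pow_mul_rel_alg:
  "u \<in> L \<Longrightarrow> x \<in> rel_alg E L j \<Longrightarrow> ((mul (lin_fn u)) ^^ k) x \<in> rel_alg E L (k + j)"
  by (induction k) (auto simp del: rel_alg.simps intro: mul_lin_rel_alg)

lemma pow_mul_commute:
  "mul w (((mul v) ^^ k) x) = ((mul v) ^^ k) (mul w x)"
  by (induction k) (auto simp: mul_left_commute[of w])

text \<open>
  Splitting off powers of a fixed \<open>u\<close> with \<open>u e = 1\<close> makes \<open>link_fn e\<close>, which acts as the derivation
  \<open>d/du\<close>, explicitly surjective: \<open>u\<^sup>k x\<close> is integrated to \<open>u\<^sup>k\<^sup>+\<^sup>1 x / (k + 1)\<close>.
\<close>

lemma rel_alg_subset_span_pow:
  assumes u: "u \<in> L" "u e = 1"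
  shows "rel_alg E L i \<subseteq> fs.span {((mul (lin_fn u)) ^^ k) x | k j x.
    k + j = i \<and> x \<in> rel_alg (E - {e}) (rel_del L e) j}"
proof -
  define B where "B = (\<lambda>i. {((mul (lin_fn u)) ^^ k) x | k j x.
    k + j = i \<and> x \<in> rel_alg (E - {e}) (rel_del L e) j})"
  have BI: "((mul (lin_fn u)) ^^ k) x \<in> B i"
    if "k + j = i" "x \<in> rel_alg (E - {e}) (rel_del L e) j" for k j x i
    unfolding B_def by (rule CollectI, intro exI conjI) (use that in auto)
  have "rel_alg E L i \<subseteq> fs.span (B i)"
  proof (induction i)
    case 0
    have "unit_fn \<in> rel_alg (E - {e}) (rel_del L e) 0" by (simp add: fs.span_base)
    then have "unit_fn \<in> B 0" using BI[of 0 0 0 unit_fn] by simp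
    then show ?case unfolding rel_alg.simps by (intro fs.span_mono) simp
  next
    case (Suc i)
    have step: "mul (lin_fn c) g \<in> fs.span (B (Suc i))" if c: "c \<in> L" and g: "g \<in> B i" for c g
    proof -
      obtain k j x where kjx: "k + j = i" "x \<in> rel_alg (E - {e}) (rel_del L e) j"
        "g = ((mul (lin_fn u)) ^^ k) x" using g unfolding B_def by blast
      \<comment> \<open>The part \<open>c0\<close> vanishes at \<open>e\<close>, commutes past the
        power of \<open>u\<close> and keeps \<open>x\<close> in the deletion algebra; the remaining
        multiple of \<open>u\<close> raises the power by one.\<close>
      define c0 where "c0 = c - fscale (c e) u"
      have c0: "c0 \<in> rel_del L e"
        using c u subspace_L unfolding rel_del_def c0_def
        by (auto intro!: fs.subspace_diff fs.subspace_scale)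
      have cc: "c = c0 + fscale (c e) u" by (simp add: c0_def)
      have "mul (lin_fn c0) x = conv (rel_indep (E - {e}) (rel_del L e)) (lin_fn c0) x"
        using mul_lin_del[OF c0 rel_alg_del_vanish[OF kjx(2)]] by simp
      then have x: "mul (lin_fn c0) x \<in> rel_alg (E - {e}) (rel_del L e) (Suc j)"
        using relation_space.mul_lin_rel_alg[OF relation_space_del c0 kjx(2)] by simp
      have "mul (lin_fn c) g = mul (lin_fn c0) g + fscale (c e) (mul (lin_fn u) g)"
        by (subst cc) (simp add: lin_fn_add lin_fn_scale conv_add_left conv_scale_left)
      moreover have "mul (lin_fn c0) g = ((mul (lin_fn u)) ^^ k) (mul (lin_fn c0) x)"
        unfolding kjx(3) by (rule pow_mul_commute)
      moreover have "\<dots> \<in> B (Suc i)" by (rule BI[OF _ x]) (use kjx(1) in simp)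
      moreover have "mul (lin_fn u) g \<in> B (Suc i)"
      proof -
        have "mul (lin_fn u) g = ((mul (lin_fn u)) ^^ (Suc k)) x" using kjx(3) by simp
        then show ?thesis using BI[OF _ kjx(2), of "Suc k" "Suc i"] kjx(1) by simp
      qed
      ultimately show ?thesis
        by (simp only:) (intro fs.span_add fs.span_scale fs.span_base; simp)
    qed
    have "mul (lin_fn c) v \<in> fs.span (B (Suc i))" if c: "c \<in> L" and v: "v \<in> rel_alg E L i" for c v
    proof -
      have "mul (lin_fn c) v \<in> mul (lin_fn c) ` fs.span (B i)" using v Suc by blast
      also have "\<dots> = fs.span (mul (lin_fn c) ` B i)" by (rule flinear_span_image[OF flinear_conv])
      also have "\<dots> \<subseteq> fs.span (B (Suc i))"
        by (rule fs.span_minimal[OF _ fs.subspace_span]) (use step[OF c] in blast)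
      finally show ?thesis .
    qed
    then show ?case by (subst rel_alg.simps(2), intro fs.span_minimal fs.subspace_span) blast
  qed
  then show ?thesis unfolding B_def .
qed

text \<open>The power rule for the derivative of u^(k+1) x with constant \<open>x\<close>, obtained
  from the Leibniz rule and the multiplicativity of restriction.\<close>

lemma link_pow:
  assumes e: "ind {e}" and u: "u e = 1" and x: "link_fn e x = 0"
  shows "link_fn e (((mul (lin_fn u)) ^^ Suc k) x) =
    fscale (of_nat (Suc k)) (res_fn ind e (((mul (lin_fn u)) ^^ k) x))"
proof (induction k)
  case 0
  then show ?case using link_mul_lin[OF e, of u x] u x by (simp add: fun_eq_iff)
next
  case (Suc k)
  let ?y = "((mul (lin_fn u)) ^^ Suc k) x"
  let ?C = "rel_indep (E - {e}) (rel_con L e)"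
  have "link_fn e (((mul (lin_fn u)) ^^ Suc (Suc k)) x) = link_fn e (mul (lin_fn u) ?y)" by simp
  also have "\<dots> = fscale (u e) (res_fn ind e ?y) + conv ?C (lin_fn (u(e := 0))) (link_fn e ?y)"
    by (rule link_mul_lin[OF e])
  also have "conv ?C (lin_fn (u(e := 0))) (link_fn e ?y) = fscale (of_nat (Suc k))
      (conv ?C (lin_fn (u(e := 0))) (res_fn ind e (((mul (lin_fn u)) ^^ k) x)))"
    unfolding Suc.IH by (rule conv_scale_right)
  also have "conv ?C (lin_fn (u(e := 0))) (res_fn ind e (((mul (lin_fn u)) ^^ k) x)) =
      res_fn ind e ?y"
    by (simp add: res_mul_lin[OF e])
  finally show ?case using u by (simp add: fun_eq_iff algebra_simps)
qed

text \<open>An element of the contraction algebra is the restriction of a combination of terms u^k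
  x, and every such term has an antiderivative within the algebra of \<open>L\<close>.\<close>

lemma rel_alg_con_subset_link:
  assumes e: "ind {e}" and u: "u \<in> L" "u e = 1"
  shows "rel_alg (E - {e}) (rel_con L e) i \<subseteq> link_fn e ` rel_alg E L (Suc i)"
proof -
  let ?I = "link_fn e ` rel_alg E L (Suc i)"
  have sI: "fs.subspace ?I"
    by (rule flinear_subspace_image[OF flinear_link_fn subspace_rel_alg])
  let ?B = "{((mul (lin_fn u)) ^^ k) x | k j x. k + j = i \<and> x \<in> rel_alg (E - {e}) (rel_del L e) j}"
  have gen: "res_fn ind e g \<in> ?I" if g: "g \<in> ?B" for g
  proof -
    obtain k j x where kjx: "k + j = i" "x \<in> rel_alg (E - {e}) (rel_del L e) j"
      "g = ((mul (lin_fn u)) ^^ k) x" using g by blast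
    have x0: "link_fn e x = 0"
      using rel_alg_del_vanish[OF kjx(2)] by (auto simp: fun_eq_iff link_fn_def)
    have "link_fn e (((mul (lin_fn u)) ^^ Suc k) x) \<in> ?I"
      using pow_mul_rel_alg[OF u(1), of x j "Suc k"] rel_alg_del_subset kjx(1,2) by auto
    \<comment> \<open>Characteristic 0 enters here.\<close>
    then have "fscale (1 / of_nat (Suc k)) (fscale (of_nat (Suc k)) (res_fn ind e g)) \<in> ?I"
      unfolding link_pow[of e u, OF e u(2) x0] kjx(3) by (rule fs.subspace_scale[OF sI])
    moreover have "(1 / of_nat (Suc k)) * (of_nat (Suc k) * q) = (q :: rat)" for q
      by (metis nonzero_mult_div_cancel_left of_nat_neq_0 times_divide_eq_left mult_1 mult.assoc)
    then have "fscale (1 / of_nat (Suc k)) (fscale (of_nat (Suc k)) (res_fn ind e g)) = res_fn ind e g"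
      by (simp only: fun_eq_iff fscale_apply) simp
    ultimately show ?thesis by simp
  qed
  have "rel_alg E L i \<subseteq> fs.span ?B" by (rule rel_alg_subset_span_pow[OF u])
  also have "\<dots> \<subseteq> {v. res_fn ind e v \<in> ?I}"
    by (rule fs.span_minimal[OF _ flinear_subspace_preimage[OF flinear_res_fn sI]]) (use gen in blast)
  finally show ?thesis using rel_alg_con_subset[OF e, of i] by blast
qed

lemma dim_rel_alg_ge:
  assumes e: "ind {e}" and u: "u \<in> L" "u e = 1"
  shows "fs.dim (rel_alg (E - {e}) (rel_con L e) i) + fs.dim (rel_alg (E - {e}) (rel_del L e) (Suc i))
    \<le> fs.dim (rel_alg E L (Suc i))"
proof -
  have outside: "link_fn e ` rel_alg E L (Suc i) \<subseteq> funs_on (Pow E)"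
  proof clarify
    fix v assume v: "v \<in> rel_alg E L (Suc i)"
    have "v S = 0" if "S \<notin> Pow E" for S
      using that rel_alg_outside[of "Suc i"] v unfolding funs_on_def by blast
    then have "link_fn e v S = 0" if "S \<notin> Pow E" for S
      using that by (auto simp: link_fn_def)
    then show "link_fn e v \<in> funs_on (Pow E)" by (simp add: funs_on_def)
  qed
  have "fs.dim (rel_alg E L (Suc i)) = fs.dim (link_fn e ` rel_alg E L (Suc i)) +
      fs.dim {v \<in> rel_alg E L (Suc i). link_fn e v = 0}"
    by (rule rank_nullity_supported[OF finite_Pow_E rel_alg_outside subspace_rel_alg flinear_link_fn])
  also have "\<dots> \<ge> fs.dim (rel_alg (E - {e}) (rel_con L e) i) +
      fs.dim (rel_alg (E - {e}) (rel_del L e) (Suc i))"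
  proof (rule add_mono)
    show "fs.dim (rel_alg (E - {e}) (rel_con L e) i) \<le> fs.dim (link_fn e ` rel_alg E L (Suc i))"
      by (rule dim_mono_supported[OF finite_Pow_E outside rel_alg_con_subset_link[OF e u]])
    have "link_fn e v = 0" if "v \<in> rel_alg (E - {e}) (rel_del L e) (Suc i)" for v
      using rel_alg_del_vanish[OF that] by (auto simp: fun_eq_iff link_fn_def)
    then have "rel_alg (E - {e}) (rel_del L e) (Suc i) \<subseteq> {v \<in> rel_alg E L (Suc i). link_fn e v = 0}"
      using rel_alg_del_subset by blast
    then show "fs.dim (rel_alg (E - {e}) (rel_del L e) (Suc i)) \<le>
        fs.dim {v \<in> rel_alg E L (Suc i). link_fn e v = 0}"
      using dim_mono_supported[OF finite_Pow_E, of "{v \<in> rel_alg E L (Suc i). link_fn e v = 0}"]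
        rel_alg_outside[of "Suc i"] by blast
  qed
  finally show ?thesis .
qed

section \<open>Dimensions of relation spaces; loops and coloops\<close>

lemma dim_L_del:
  assumes u: "u \<in> L" "u e \<noteq> 0"
  shows "fs.dim L = fs.dim (rel_del L e) + 1"
proof -
  \<comment> \<open>Evaluation at \<open>e\<close>, its values regarded as functions on a
    one-element type so that rank-nullity for function spaces applies.\<close>
  let ?f = "\<lambda>c::'a \<Rightarrow> rat. \<lambda>_::unit. c e"
  have f: "flinear ?f" by (rule flinearI) (auto simp: fun_eq_iff)
  have L: "L \<subseteq> funs_on E" using supported unfolding funs_on_def by blast
  have "?f u \<noteq> 0" using u(2) by (auto simp: fun_eq_iff)
  moreover have "?f ` L = fs.span {?f u}"
  proof
    show "?f ` L \<subseteq> fs.span {?f u}"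
    proof clarify
      fix c
      have "?f c = fscale (c e / u e) (?f u)" using u(2) by (simp add: fun_eq_iff)
      also have "\<dots> \<in> fs.span {?f u}" by (intro fs.span_scale fs.span_base) simp
      finally show "?f c \<in> fs.span {?f u}" .
    qed
    show "fs.span {?f u} \<subseteq> ?f ` L"
      by (intro fs.span_minimal flinear_subspace_image[OF f subspace_L]) (use u in auto)
  qed
  ultimately have "fs.dim (?f ` L) = 1" using dim_span_singleton[of "?f u"] by simp
  moreover have "{c \<in> L. ?f c = 0} = rel_del L e" unfolding rel_del_def by (auto simp: fun_eq_iff)
  ultimately show ?thesis using rank_nullity_supported[OF finite_E L subspace_L f] by simp
qed

lemma dim_L_con:
  assumes e: "ind {e}"
  shows "fs.dim (rel_con L e) = fs.dim L"
proof -
  have L: "L \<subseteq> funs_on E" using supported unfolding funs_on_def by blast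
  have "c = 0" if "c \<in> L" "c(e := 0) = 0" for c
  proof -
    have "\<forall>x. x \<notin> {e} \<longrightarrow> c x = 0" using that(2) by (metis fun_upd_apply singletonI zero_fun_apply)
    then show ?thesis using e that(1) unfolding rel_indep_def by blast
  qed
  then have "{c \<in> L. c(e := 0) = 0} \<subseteq> fs.span {}" by auto
  then have "fs.dim {c \<in> L. c(e := 0) = 0} \<le> card ({} :: ('a \<Rightarrow> rat) set)"
    by (intro fs.dim_le_card) auto
  then show ?thesis
    using rank_nullity_supported[OF finite_E L subspace_L flinear_upd[of e]] unfolding rel_con_def by simp
qed

text \<open>For a coloop the indicator of \<open>e\<close> is orthogonal to \<open>L\<close>;
  balancing with it isolates the coefficient at \<open>insert e S\<close> and forces it to be
  0.\<close>

lemma balanced_del_coloop: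
  assumes e: "e \<in> E" and col: "\<And>c. c \<in> L \<Longrightarrow> c e = 0"
  shows "balanced E L i \<subseteq> balanced (E - {e}) (rel_del L e) i"
proof
  fix v assume v: "v \<in> balanced E L i"
  have "v (insert e S) = 0" if S: "e \<notin> S" for S
  proof -
    let ?l = "\<lambda>x. if x = e then 1 else 0 :: rat"
    have "(\<Sum>x\<in>E. ?l x * c x) = 0" if "c \<in> L" for c
      using col[OF that] by (intro sum.neutral) auto
    then have "(\<Sum>x\<in>E - S. ?l x * v (insert x S)) = 0"
      by (rule balancedD[OF v]) (use S in auto)
    moreover have "(\<Sum>x\<in>E - S. ?l x * v (insert x S)) = (\<Sum>x\<in>{e}. ?l x * v (insert x S))"
      using finite_E e S by (intro sum.mono_neutral_right) auto
    ultimately show ?thesis by simp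
  qed
  then have "link_fn e v = 0" by (auto simp: link_fn_def fun_eq_iff)
  then show "v \<in> balanced (E - {e}) (rel_del L e) i" using balanced_del[OF e v] by blast
qed

lemma balanced_del_loop:
  assumes e: "e \<in> E" "\<not> ind {e}"
  shows "balanced E L i \<subseteq> balanced (E - {e}) (rel_del L e) i"
proof
  fix v assume v: "v \<in> balanced E L i"
  have "v S = 0" if S: "e \<in> S" for S
    using balanced_supp[OF v] ind_subset[of S "{e}"] e(2) S by blast
  then have "link_fn e v = 0" by (auto simp: link_fn_def fun_eq_iff)
  then show "v \<in> balanced (E - {e}) (rel_del L e) i" using balanced_del[OF e(1) v] by blast
qed

lemma dim_balanced_above:
  assumes "\<And>S. ind S \<Longrightarrow> card S \<le> m" "m < i"
  shows "fs.dim (balanced E L i) = 0"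
proof -
  have "v = 0" if v: "v \<in> balanced E L i" for v
    using balanced_supp[OF v] assms by (force simp: fun_eq_iff)
  then have "balanced E L i \<subseteq> fs.span {}" by auto
  then have "fs.dim (balanced E L i) \<le> card ({} :: ('a set \<Rightarrow> rat) set)"
    by (intro fs.dim_le_card) auto
  then show ?thesis by simp
qed

lemma sum_ind_split:
  fixes f :: "'a set \<Rightarrow> 'r::comm_monoid_add"
  assumes e: "ind {e}"
  shows "(\<Sum>S | ind S. f S) = (\<Sum>S | rel_indep (E - {e}) (rel_del L e) S. f S) +
    (\<Sum>S | rel_indep (E - {e}) (rel_con L e) S. f (insert e S))"
proof -
  have fin: "finite {S. ind S}"
    by (rule finite_subset[OF _ finite_Pow_E]) (auto simp: rel_indep_def)
  let ?A = "{S. rel_indep (E - {e}) (rel_del L e) S}"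
  let ?B = "insert e ` {S. rel_indep (E - {e}) (rel_con L e) S}"
  have eq: "{S. ind S} = ?A \<union> ?B"
  proof (intro Set.set_eqI iffI)
    fix S assume "S \<in> {S. ind S}"
    then show "S \<in> ?A \<union> ?B"
      using ind_del ind_con[OF e]
      by (cases "e \<in> S") (auto intro!: image_eqI[of _ _ "S - {e}"] simp: insert_absorb)
  next
    fix S assume "S \<in> ?A \<union> ?B"
    then show "S \<in> {S. ind S}" using ind_del ind_con[OF e] by auto
  qed
  have "(\<Sum>S | ind S. f S) = sum f ?A + sum f ?B"
    unfolding eq
  proof (rule sum.union_disjoint)
    show "finite ?A" "finite ?B" using fin unfolding eq by simp_all
    show "?A \<inter> ?B = {}" using ind_del by blast
  qed
  also have "sum f ?B = (\<Sum>S | rel_indep (E - {e}) (rel_con L e) S. f (insert e S))"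
  proof -
    have "inj_on (insert e) {S. rel_indep (E - {e}) (rel_con L e) S}"
    proof (rule inj_onI)
      fix S T assume "S \<in> {S. rel_indep (E - {e}) (rel_con L e) S}"
        "T \<in> {S. rel_indep (E - {e}) (rel_con L e) S}" and eq: "insert e S = insert e T"
      then have "e \<notin> S" "e \<notin> T" using ind_con[OF e] by auto
      then show "S = T" using eq insert_ident[of e S T] by simp
    qed
    then show ?thesis by (simp add: sum.reindex)
  qed
  finally show ?thesis .
qed

end

(* As a simp rule it would also rewrite the unapplied fscale hidden in the abbreviation fs.dim. *)
declare fscale_apply [simp del]

section \<open>The Hilbert function by deletion and contraction\<close>

text \<open>The conjuncts support one another in a single induction: the dimension formula tells how
  the rank \<open>m\<close>, and with it the exponents, changes; equality with the balanced weights
  closes the gap between the two opposite recursions. The intended value of \<open>y\<close> is t -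
  1, so that \<open>y + 1\<close> is t.\<close>

lemma rel_hilbert:
  fixes y :: "'r::comm_ring_1" and E :: "'a set"
  assumes "relation_space E L"
  shows "\<exists>m. m + fs.dim L = card E \<and> (\<forall>S. rel_indep E L S \<longrightarrow> card S \<le> m) \<and>
    (\<exists>S. rel_indep E L S \<and> card S = m) \<and>
    (\<forall>i. fs.dim (balanced E L i) = fs.dim (rel_alg E L i)) \<and>
    (\<Sum>S | rel_indep E L S. y ^ (m - card S)) =
      (\<Sum>i\<le>m. of_nat (fs.dim (rel_alg E L i)) * (y + 1) ^ (m - i))"
proof -
  have "finite E" using assms relation_space.finite_E by blast
  then show ?thesis using assms
  proof (induction E arbitrary: L rule: finite_induct)
    case empty
    interpret relation_space "{}" L by (rule empty)
    have L: "L = {0}"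
      using supported fs.subspace_0[OF subspace_L] by (auto simp: fun_eq_iff)
    have ind_iff: "ind S \<longleftrightarrow> S = {}" for S unfolding rel_indep_def L by auto
    have "fs.dim L = card ({} :: ('a \<Rightarrow> rat) set)"
      using L by (intro fs.dim_eq_card) (auto simp: fs.span_singleton fs.independent_empty)
    moreover have "fs.dim (balanced {} L i) = fs.dim (rel_alg {} L i)" for i
    proof (cases i)
      case 0
      then show ?thesis using dim_balanced_0 dim_rel_alg_0 by simp
    next
      case (Suc j)
      then have "fs.dim (balanced {} L i) = 0"
        using dim_balanced_above[of 0 i] ind_iff by simp
      then show ?thesis using dim_rel_alg_le_balanced[of i] by simp
    qed
    moreover have "(\<Sum>S | ind S. y ^ (0 - card S)) =
        (\<Sum>i\<le>0. of_nat (fs.dim (rel_alg {} L i)) * (y + 1) ^ (0 - i))"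
      unfolding ind_iff atMost_0 using dim_rel_alg_0 by (simp del: rel_alg.simps)
    moreover have "0 + fs.dim L = card ({} :: 'a set)" using \<open>fs.dim L = _\<close> by simp
    moreover have "\<forall>S. ind S \<longrightarrow> card S \<le> 0" "\<exists>S. ind S \<and> card S = 0" unfolding ind_iff by auto
    ultimately show ?case by blast
  next
    case (insert e F)
    interpret relation_space "insert e F" L by (rule insert.prems)
    have F: "insert e F - {e} = F" using insert.hyps by simp
    interpret C: relation_space F "rel_con L e" using relation_space_con[of e] F by simp
    interpret D: relation_space F "rel_del L e" using relation_space_del[of e] F by simp
    note ind_del = ind_del[of e, unfolded F]
    note alg_del = rel_alg_del_subset[of e, unfolded F]
    obtain m where m: "m + fs.dim (rel_del L e) = card F"
      "\<And>S. D.ind S \<Longrightarrow> card S \<le> m" "\<exists>S. D.ind S \<and> card S = m"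
      "\<And>i. fs.dim (balanced F (rel_del L e) i) = fs.dim (rel_alg F (rel_del L e) i)"
      "(\<Sum>S | D.ind S. y ^ (m - card S)) =
        (\<Sum>i\<le>m. of_nat (fs.dim (rel_alg F (rel_del L e) i)) * (y + 1) ^ (m - i))"
      using insert.IH[OF D.relation_space_axioms] by blast
    \<comment> \<open>The chain from the deletion algebra through the algebra and its balanced
      weights to the balanced weights of the deletion has ends of equal dimension. This settles
      loops and coloops.\<close>
    have dims: "fs.dim (rel_alg (insert e F) L i) = fs.dim (rel_alg F (rel_del L e) i) \<and>
        fs.dim (balanced (insert e F) L i) = fs.dim (rel_alg F (rel_del L e) i)"
      if "balanced (insert e F) L i \<subseteq> balanced F (rel_del L e) i" for i
    proof -
      have "fs.dim (rel_alg F (rel_del L e) i) \<le> fs.dim (rel_alg (insert e F) L i)"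
        by (rule dim_mono_supported[OF finite_Pow_E rel_alg_outside alg_del])
      moreover have "fs.dim (balanced (insert e F) L i) \<le> fs.dim (balanced F (rel_del L e) i)"
        by (rule dim_mono_supported[OF D.finite_Pow_E D.balanced_outside that])
      ultimately show ?thesis using dim_rel_alg_le_balanced[of i] m(4)[of i] by linarith
    qed
    show ?case
    proof (cases "ind {e}")
      case False
      then obtain c where c: "c \<in> L" "\<forall>x. x \<notin> {e} \<longrightarrow> c x = 0" "c \<noteq> 0"
        unfolding rel_indep_def by blast
      then have ce: "c e \<noteq> 0" by (auto simp: fun_eq_iff)
      have "D.ind S \<longleftrightarrow> ind S" for S
        using ind_del[of S] ind_subset[of S "{e}"] False by blast
      then have eq: "D.ind = ind" by (intro ext) blast
      have dm: "fs.dim (rel_alg (insert e F) L i) = fs.dim (rel_alg F (rel_del L e) i)"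
        "fs.dim (balanced (insert e F) L i) = fs.dim (rel_alg F (rel_del L e) i)" for i
        using dims[of i] balanced_del_loop[of e i, unfolded F] False by auto
      show ?thesis
      proof (intro exI[of _ m] conjI allI impI)
        show "m + fs.dim L = card (insert e F)"
          using dim_L_del[of c e, OF c(1) ce] m(1) insert.hyps by simp
      qed (use m eq dm in auto)
    next
      case e: True
      show ?thesis
      proof (cases "\<exists>u\<in>L. u e \<noteq> 0")
        case False
        then have col: "\<And>c. c \<in> L \<Longrightarrow> c e = 0" by blast
        then have Ld: "rel_del L e = L" unfolding rel_del_def by blast
        have "rel_con L e = id ` L" unfolding rel_con_def
          by (rule image_cong) (use col in \<open>auto simp: fun_eq_iff\<close>)
        then have Lc: "rel_con L e = L" by simp
        have ins: "ind (insert e S) \<and> e \<notin> S" if "D.ind S" for S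
          using ind_con[OF e, of S, unfolded F] that Ld Lc by simp
        have sub: "balanced (insert e F) L i \<subseteq> balanced F (rel_del L e) i" for i
          by (subst (2) F[symmetric], rule balanced_del_coloop) (auto intro: col)
        have dm: "fs.dim (rel_alg (insert e F) L i) = fs.dim (rel_alg F (rel_del L e) i)"
          "fs.dim (balanced (insert e F) L i) = fs.dim (rel_alg F (rel_del L e) i)" for i
          using dims[OF sub[of i]] by auto
        show ?thesis
        proof (intro exI[of _ "Suc m"] conjI allI impI)
          show "Suc m + fs.dim L = card (insert e F)"
            using m(1) insert.hyps Ld by simp
          show "card S \<le> Suc m" if S: "ind S" for S
          proof (cases "e \<in> S")
            case True
            have "D.ind (S - {e})" using S ind_subset[of S "S - {e}"] ind_del by blast
            then have "card (S - {e}) \<le> m" using m(2) by blast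
            then show ?thesis using True ind_finite[OF S] by (simp add: card_Diff_singleton_if)
          next
            case False
            then have "D.ind S" using S ind_del by blast
            then show ?thesis using m(2) le_SucI by blast
          qed
          obtain S where S: "D.ind S" "card S = m" using m(3) by blast
          have "ind (insert e S) \<and> card (insert e S) = Suc m"
            using ins[OF S(1)] S(2) D.ind_finite[OF S(1)] by simp
          then show "\<exists>S. ind S \<and> card S = Suc m" by blast
          show "fs.dim (balanced (insert e F) L i) = fs.dim (rel_alg (insert e F) L i)" for i
            using dm by simp
          have "(\<Sum>S | ind S. y ^ (Suc m - card S)) = (\<Sum>S | D.ind S. y ^ (Suc m - card S)) +
              (\<Sum>S | D.ind S. y ^ (Suc m - card (insert e S)))"
            using sum_ind_split[OF e, of "\<lambda>S. y ^ (Suc m - card S)", unfolded F] Ld Lc by simp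
          also have "(\<Sum>S | D.ind S. y ^ (Suc m - card S)) = y * (\<Sum>S | D.ind S. y ^ (m - card S))"
            unfolding sum_distrib_left using m(2) by (intro sum.cong) (auto simp: Suc_diff_le)
          also have "(\<Sum>S | D.ind S. y ^ (Suc m - card (insert e S))) = (\<Sum>S | D.ind S. y ^ (m - card S))"
            using ins D.ind_finite by (intro sum.cong) auto
          \<comment> \<open>Sets avoiding the coloop contribute a factor \<open>y\<close> and sets
            containing it a factor 1.\<close>
          also have "y * (\<Sum>S | D.ind S. y ^ (m - card S)) + (\<Sum>S | D.ind S. y ^ (m - card S)) =
              (y + 1) * (\<Sum>i\<le>m. of_nat (fs.dim (rel_alg F (rel_del L e) i)) * (y + 1) ^ (m - i))"
            unfolding m(5) by (simp add: algebra_simps)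
          also have "\<dots> = (\<Sum>i\<le>m. of_nat (fs.dim (rel_alg F (rel_del L e) i)) * (y + 1) ^ (Suc m - i))"
            unfolding sum_distrib_left by (intro sum.cong) (auto simp: Suc_diff_le mult_ac)
          \<comment> \<open>The added top term is 0, because the deletion has no independent set
            with \<open>Suc m\<close> elements.\<close>
          also have "\<dots> = (\<Sum>i\<le>Suc m. of_nat (fs.dim (rel_alg F (rel_del L e) i)) * (y + 1) ^ (Suc m - i))"
            using D.dim_balanced_above[OF m(2), of "Suc m"] m(4)[of "Suc m"] by simp
          finally show "(\<Sum>S | ind S. y ^ (Suc m - card S)) =
              (\<Sum>i\<le>Suc m. of_nat (fs.dim (rel_alg (insert e F) L i)) * (y + 1) ^ (Suc m - i))"
            unfolding dm .
        qed
      next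
        case True
        then obtain u' where u': "u' \<in> L" "u' e \<noteq> 0" by blast
        define u where "u = fscale (1 / u' e) u'"
        have u: "u \<in> L" "u e = 1"
          using u' fs.subspace_scale[OF subspace_L] by (auto simp: u_def fscale_apply)
        obtain k where k: "k + fs.dim (rel_con L e) = card F"
          "\<And>S. C.ind S \<Longrightarrow> card S \<le> k" "\<exists>S. C.ind S \<and> card S = k"
          "\<And>i. fs.dim (balanced F (rel_con L e) i) = fs.dim (rel_alg F (rel_con L e) i)"
          "(\<Sum>S | C.ind S. y ^ (k - card S)) =
            (\<Sum>i\<le>k. of_nat (fs.dim (rel_alg F (rel_con L e) i)) * (y + 1) ^ (k - i))"
          using insert.IH[OF C.relation_space_axioms] by blast
        \<comment> \<open>Contraction keeps the dimension of \<open>L\<close> and deletion lowers it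
          by one, on the same ground set.\<close>
        have km: "m = Suc k"
          using k(1) m(1) dim_L_con[OF e] dim_L_del[of u' e, OF u'] by linarith
        note ind_con = ind_con[OF e, unfolded F]
        \<comment> \<open>By induction the upper bound for the balanced weights equals the lower
          bound for the algebra, which lies between them.\<close>
        have dm: "fs.dim (rel_alg (insert e F) L (Suc i)) =
            fs.dim (rel_alg F (rel_con L e) i) + fs.dim (rel_alg F (rel_del L e) (Suc i))"
          "fs.dim (balanced (insert e F) L (Suc i)) = fs.dim (rel_alg (insert e F) L (Suc i))" for i
          using dim_balanced_le[OF e, of i, unfolded F] dim_rel_alg_ge[OF e u, of i, unfolded F]
            dim_rel_alg_le_balanced[of "Suc i"] m(4)[of "Suc i"] k(4)[of i] by linarith+
        show ?thesis
        proof (intro exI[of _ m] conjI allI impI)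
          show "m + fs.dim L = card (insert e F)"
            using m(1) insert.hyps dim_L_del[of u' e, OF u'] by simp
          show "card S \<le> m" if S: "ind S" for S
          proof (cases "e \<in> S")
            case True
            then have "C.ind (S - {e})" using S ind_con by (simp add: insert_absorb)
            then have "card (S - {e}) \<le> k" using k(2) by blast
            then show ?thesis using True ind_finite[OF S] km by (simp add: card_Diff_singleton_if)
          next
            case False
            then have "D.ind S" using S ind_del by blast
            then show ?thesis using m(2) by blast
          qed
          show "\<exists>S. ind S \<and> card S = m" using m(3) ind_del by blast
          show "fs.dim (balanced (insert e F) L i) = fs.dim (rel_alg (insert e F) L i)" for i
            using dm(2) dim_balanced_0 dim_rel_alg_0 by (cases i) (simp_all del: rel_alg.simps)
          have "(\<Sum>S | ind S. y ^ (m - card S)) = (\<Sum>S | D.ind S. y ^ (m - card S)) +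
              (\<Sum>S | C.ind S. y ^ (m - card (insert e S)))"
            by (rule sum_ind_split[OF e, unfolded F])
          also have "(\<Sum>S | C.ind S. y ^ (m - card (insert e S))) = (\<Sum>S | C.ind S. y ^ (k - card S))"
            using ind_con C.ind_finite km by (intro sum.cong) auto
          also have "(\<Sum>S | D.ind S. y ^ (m - card S)) + (\<Sum>S | C.ind S. y ^ (k - card S)) =
              (\<Sum>i\<le>m. of_nat (fs.dim (rel_alg (insert e F) L i)) * (y + 1) ^ (m - i))"
            \<comment> \<open>With degree 0 split off, where the deletion alone contributes, the
              recursion matches the terms of degree \<open>Suc i\<close>.\<close>
            unfolding k(5) m(5) unfolding km sum.atMost_Suc_shift dm(1) dim_rel_alg_0 D.dim_rel_alg_0
            by (simp add: sum.distrib algebra_simps del: rel_alg.simps)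
          finally show "(\<Sum>S | ind S. y ^ (m - card S)) =
              (\<Sum>i\<le>m. of_nat (fs.dim (rel_alg (insert e F) L i)) * (y + 1) ^ (m - i))" .
        qed
      qed
    qed
  qed
qed

section \<open>Injectivity of multiplication by a nowhere zero relation\<close>

text \<open>
  The value at \<open>S\<close> is recovered as a combination of the sums over the sets \<open>T \<subseteq> S \<union> X\<close>, with a
  coefficient \<open>a r\<close> depending only on \<open>r = card (T \<inter> X)\<close>. The recursion for \<open>a\<close> says that all values
  other than the one at \<open>S\<close> cancel.
\<close>

lemma boolean_inclusion_injective:
  fixes v :: "'a set \<Rightarrow> rat"
  assumes fin: "finite S" "finite X" and disj: "S \<inter> X = {}" and card: "card X = Suc (card S)"
    and zero: "\<And>T. T \<subseteq> S \<union> X \<Longrightarrow> card T = Suc (card S) \<Longrightarrow> (\<Sum>x\<in>T. v (T - {x})) = 0"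
  shows "v S = 0"
proof -
  define j where "j = card S"
  \<comment> \<open>Solves the cancellation recursion upwards from \<open>a 1 = 1 / (j + 1)\<close>.
    The divisor counts the elements of \<open>X\<close> outside a \<open>j\<close>-set that meets
    \<open>X\<close> in \<open>r\<close> elements; it is nonzero for
    \<open>r \<le> j\<close>.\<close>
  define a :: "nat \<Rightarrow> rat" where "a = rec_nat 0 (\<lambda>r q.
    (if r = 0 then 1 else - (of_nat r * q)) / (of_nat (Suc j) - of_nat r))"
  have a_rec: "(of_nat (Suc j) - of_nat r) * a (Suc r) + of_nat r * a r = (if r = 0 then 1 else 0)"
    if "r \<le> j" for r
  proof -
    have "of_nat r \<noteq> (of_nat (Suc j) :: rat)" using that by (simp only: of_nat_eq_iff)
    then have "(of_nat (Suc j) - of_nat r) * a (Suc r) = (if r = 0 then 1 else - (of_nat r * a r))"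
      by (simp add: a_def)
    then show ?thesis by simp
  qed
  define U where "U = S \<union> X"
  have finU: "finite U" using fin by (simp add: U_def)
  define TT where "TT = {T. T \<subseteq> U \<and> card T = Suc j}"
  define RR where "RR = {R. R \<subseteq> U \<and> card R = j}"
  have finTR: "finite TT" "finite RR" unfolding TT_def RR_def using finU by auto
  have finT: "finite T" if "T \<in> TT" for T using that finU unfolding TT_def by (auto intro: finite_subset)
  have finR: "finite R" if "R \<in> RR" for R using that finU unfolding RR_def by (auto intro: finite_subset)
  \<comment> \<open>The coefficient with which \<open>v R\<close> enters the weighted sum. Adding an
    element of \<open>X\<close> to \<open>R\<close> is possible in j + 1 - r ways and raises the
    intersection to r + 1; adding one of \<open>S\<close> is possible in r ways and keeps it at
    r.\<close>
  have inner: "(\<Sum>x\<in>U - R. a (card (insert x R \<inter> X))) = (if R = S then 1 else 0)" if R: "R \<in> RR" for R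
  proof -
    define r where "r = card (R \<inter> X)"
    have RU: "R \<subseteq> U" "card R = j" using R unfolding RR_def by auto
    have split: "card (R \<inter> S) + r = j"
    proof -
      have "R = (R \<inter> S) \<union> (R \<inter> X)" using RU(1) unfolding U_def by blast
      then have "card R = card (R \<inter> S) + card (R \<inter> X)"
        using card_Un_disjoint[of "R \<inter> S" "R \<inter> X"] finR[OF R] disj by auto
      then show ?thesis using RU(2) r_def by simp
    qed
    have "(\<Sum>x\<in>U - R. a (card (insert x R \<inter> X))) =
        (\<Sum>x\<in>X - R. a (card (insert x R \<inter> X))) + (\<Sum>x\<in>S - R. a (card (insert x R \<inter> X)))"
    proof -
      have "U - R = (X - R) \<union> (S - R)" unfolding U_def by blast
      moreover have "finite (X - R)" "finite (S - R)" "(X - R) \<inter> (S - R) = {}"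
        using fin disj by auto
      ultimately show ?thesis by (simp only: sum.union_disjoint)
    qed
    also have "(\<Sum>x\<in>X - R. a (card (insert x R \<inter> X))) = (\<Sum>x\<in>X - R. a (Suc r))"
      using finR[OF R] by (intro sum.cong) (auto simp: r_def Int_insert_left)
    also have "\<dots> = (of_nat (Suc j) - of_nat r) * a (Suc r)"
    proof -
      have "card (X - R) = Suc j - r"
        using card_Diff_subset_Int[of X R] finR[OF R] card by (simp add: r_def j_def Int_commute)
      moreover have "r \<le> Suc j" using split by simp
      ultimately show ?thesis by (simp add: of_nat_diff)
    qed
    also have "(\<Sum>x\<in>S - R. a (card (insert x R \<inter> X))) = (\<Sum>x\<in>S - R. a r)"
      using disj by (intro sum.cong) (auto simp: r_def Int_insert_left)
    also have "\<dots> = of_nat r * a r"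
    proof -
      have "card (S - R) = r"
        using card_Diff_subset_Int[of S R] finR[OF R] split by (simp add: j_def Int_commute)
      then show ?thesis by simp
    qed
    also have "(of_nat (Suc j) - of_nat r) * a (Suc r) + of_nat r * a r = (if r = 0 then 1 else 0)"
      using a_rec split by simp
    also have "r = 0 \<longleftrightarrow> R = S"
    proof
      assume "r = 0"
      then have "R \<inter> X = {}" using finR[OF R] by (simp add: r_def)
      then have "R \<subseteq> S" using RU(1) unfolding U_def by blast
      then show "R = S" using card_subset_eq[OF fin(1)] RU(2) j_def by simp
    next
      assume "R = S"
      then show "r = 0" using disj by (simp add: r_def)
    qed
    finally show ?thesis .
  qed
  have "0 = (\<Sum>T\<in>TT. a (card (T \<inter> X)) * (\<Sum>x\<in>T. v (T - {x})))"
  proof (intro sum.neutral[symmetric] ballI)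
    fix T assume "T \<in> TT"
    then show "a (card (T \<inter> X)) * (\<Sum>x\<in>T. v (T - {x})) = 0"
      using zero[of T] unfolding TT_def U_def j_def by simp
  qed
  also have "\<dots> = (\<Sum>(T,x)\<in>Sigma TT (\<lambda>T. T). a (card (T \<inter> X)) * v (T - {x}))"
    unfolding sum_distrib_left using finTR(1) finT by (subst sum.Sigma) auto
  \<comment> \<open>Double counting: a set \<open>T\<close> with a marked element \<open>x\<close>
    is the set \<open>R = T - {x}\<close> with \<open>x\<close> as a new element.\<close>
  also have "\<dots> = (\<Sum>(R,x)\<in>Sigma RR (\<lambda>R. U - R). v R * a (card (insert x R \<inter> X)))"
  proof (rule sum.reindex_bij_witness[where i = "\<lambda>(R,x). (insert x R, x)"
        and j = "\<lambda>(T,x). (T - {x}, x)"], goal_cases)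
    case (1 p)
    then obtain T x where "p = (T, x)" "x \<in> T" by blast
    then show ?case by (simp add: insert_absorb)
  next
    case (2 p)
    then obtain T x where p: "p = (T, x)" "x \<in> T" "T \<in> TT" by blast
    have "card (T - {x}) = j" using p finT[OF p(3)] unfolding TT_def by simp
    moreover have "T \<subseteq> U" using p(3) unfolding TT_def by simp
    ultimately show ?case using p unfolding RR_def by auto
  next
    case (3 p)
    then obtain R x where "p = (R, x)" "x \<in> U - R" by blast
    then show ?case by simp
  next
    case (4 p)
    then obtain R x where p: "p = (R, x)" "x \<in> U - R" "R \<in> RR" by blast
    have "card (insert x R) = Suc j" using p finR[OF p(3)] unfolding RR_def by simp
    moreover have "R \<subseteq> U" using p(3) unfolding RR_def by simp
    ultimately show ?case using p unfolding TT_def by auto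
  next
    case (5 p)
    then obtain T x where "p = (T, x)" "x \<in> T" by blast
    moreover from this have "insert x (T - {x}) = T" by blast
    ultimately show ?case by (simp only: split_conv mult.commute)
  qed
  also have "\<dots> = (\<Sum>R\<in>RR. v R * (\<Sum>x\<in>U - R. a (card (insert x R \<inter> X))))"
    unfolding sum_distrib_left using finTR(2) finU by (subst sum.Sigma) auto
  also have "\<dots> = (\<Sum>R\<in>RR. if R = S then v R else 0)"
    using inner by (intro sum.cong) auto
  also have "\<dots> = v S"
  proof -
    have "S \<in> RR" unfolding RR_def U_def j_def by simp
    then show ?thesis using finTR(2) by simp
  qed
  finally show ?thesis by simp
qed

text \<open>Dividing \<open>v R\<close> by the product of the weights on \<open>R\<close> turns the
  weighted sum over \<open>T\<close> into the plain one, up to the nonzero factor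
  \<open>prod w T\<close>.\<close>

lemma weighted_inclusion_injective:
  fixes v :: "'a set \<Rightarrow> rat"
  assumes fin: "finite S" "finite X" and disj: "S \<inter> X = {}" and card: "card X = Suc (card S)"
    and w: "\<And>x. x \<in> S \<union> X \<Longrightarrow> w x \<noteq> 0"
    and zero: "\<And>T. T \<subseteq> S \<union> X \<Longrightarrow> card T = Suc (card S) \<Longrightarrow> (\<Sum>x\<in>T. w x * v (T - {x})) = 0"
  shows "v S = 0"
proof -
  let ?v = "\<lambda>R. v R / prod w R"
  have "?v S = 0"
  proof (rule boolean_inclusion_injective[OF fin disj card])
    fix T assume T: "T \<subseteq> S \<union> X" "card T = Suc (card S)"
    have finT: "finite T" using T(1) fin by (auto intro: finite_subset)
    have nz: "prod w T \<noteq> 0" using w T(1) finT by auto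
    have "prod w T * (\<Sum>x\<in>T. ?v (T - {x})) = (\<Sum>x\<in>T. w x * v (T - {x}))"
      unfolding sum_distrib_left
    proof (rule sum.cong[OF refl])
      fix x assume x: "x \<in> T"
      have "prod w T = w x * prod w (T - {x})" using prod.remove[OF finT x] by simp
      moreover have "prod w (T - {x}) \<noteq> 0" using w T(1) finT by auto
      ultimately show "prod w T * ?v (T - {x}) = w x * v (T - {x})" by simp
    qed
    also have "\<dots> = 0" by (rule zero[OF T])
    finally show "(\<Sum>x\<in>T. ?v (T - {x})) = 0" using nz by simp
  qed
  moreover have "prod w S \<noteq> 0" using w fin by auto
  ultimately show ?thesis by simp
qed

text \<open>All subsets of an independent \<open>B\<close> are independent, so nothing is cut off
  there and the product with \<open>w\<close> is the full weighted inclusion map. The bound on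
  \<open>card B\<close> leaves j + 1 elements outside \<open>S\<close> to form
  \<open>X\<close>.\<close>

lemma (in relation_space) mul_lin_injective:
  assumes w: "\<And>x. x \<in> E \<Longrightarrow> w x \<noteq> 0"
    and ext: "\<And>S. ind S \<Longrightarrow> card S = j \<Longrightarrow> \<exists>B. S \<subseteq> B \<and> ind B \<and> 2 * j + 1 \<le> card B"
    and v: "\<And>S. v S \<noteq> 0 \<Longrightarrow> ind S \<and> card S = j"
    and zero: "mul (lin_fn w) v = 0"
  shows "v = 0"
proof
  fix S
  show "v S = 0 S"
  proof (cases "ind S \<and> card S = j")
    case False
    then show ?thesis using v by auto
  next
    case True
    then obtain B where B: "S \<subseteq> B" "ind B" "2 * j + 1 \<le> card B" using ext by blast
    have finB: "finite B" "finite S" using B ind_finite finite_subset by blast+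
    have "card (B - S) = card B - j" using B(1) finB True by (simp add: card_Diff_subset)
    then have "Suc j \<le> card (B - S)" using B(3) by linarith
    then obtain X where X: "X \<subseteq> B - S" "card X = Suc j" "finite X"
      using obtain_subset_with_card_n by metis
    have BE: "B \<subseteq> E" using B(2) unfolding rel_indep_def by blast
    have "v S = 0"
    proof (rule weighted_inclusion_injective[OF finB(2) X(3), of w])
      show "S \<inter> X = {}" using X(1) by blast
      show "card X = Suc (card S)" using X(2) True by simp
      show "w x \<noteq> 0" if "x \<in> S \<union> X" for x using that X(1) B(1) BE w by blast
      fix T assume T: "T \<subseteq> S \<union> X"
      then have "ind T" using ind_subset[OF B(2)] X(1) B(1) by blast
      moreover have "mul (lin_fn w) v T = 0" using zero by simp
      ultimately show "(\<Sum>x\<in>T. w x * v (T - {x})) = 0" by (simp add: mul_lin)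
    qed
    then show ?thesis by simp
  qed
qed

section \<open>Quotients of graded algebras with natural numbers as carrier\<close>

text \<open>Representatives are chosen by a predicate that depends only on the class modulo
  \<open>K\<close>, so congruent elements receive the same one; an enumeration of \<open>U\<close>
  then numbers the representatives.\<close>

lemma ex_countable_quotient_code:
  fixes U :: "'v::ab_group_add set"
  assumes "countable U" "0 \<in> K" "\<And>x y. x \<in> K \<Longrightarrow> y \<in> K \<Longrightarrow> x - y \<in> K"
  shows "\<exists>code :: 'v \<Rightarrow> nat. \<forall>x\<in>U. \<forall>y\<in>U. code x = code y \<longleftrightarrow> x - y \<in> K"
proof -
  define rep where "rep x = (SOME z. z \<in> U \<and> x - z \<in> K)" for x
  have rep: "rep x \<in> U \<and> x - rep x \<in> K" if "x \<in> U" for x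
    unfolding rep_def by (rule someI[of _ x]) (use that assms(2) in simp)
  have neg: "- x \<in> K" if "x \<in> K" for x using assms(3)[OF assms(2) that] by simp
  have add: "x + y \<in> K" if "x \<in> K" "y \<in> K" for x y using assms(3)[OF that(1) neg[OF that(2)]] by simp
  have "to_nat_on U (rep x) = to_nat_on U (rep y) \<longleftrightarrow> x - y \<in> K" if x: "x \<in> U" and y: "y \<in> U" for x y
  proof
    assume "to_nat_on U (rep x) = to_nat_on U (rep y)"
    then have "rep x = rep y" using rep x y to_nat_on_inj[OF assms(1)] by blast
    then have "(x - rep x) - (y - rep y) = x - y" by simp
    then show "x - y \<in> K" using assms(3) rep x y by metis
  next
    assume xy: "x - y \<in> K"
    have "x - z \<in> K \<longleftrightarrow> y - z \<in> K" for z
    proof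
      assume "x - z \<in> K"
      then have "(x - z) - (x - y) \<in> K" using assms(3) xy by blast
      then show "y - z \<in> K" by simp
    next
      assume "y - z \<in> K"
      then have "(x - y) + (y - z) \<in> K" using add xy by blast
      then show "x - z \<in> K" by simp
    qed
    then show "to_nat_on U (rep x) = to_nat_on U (rep y)" unfolding rep_def by simp
  qed
  then show ?thesis by (intro exI[of _ "\<lambda>x. to_nat_on U (rep x)"]) blast
qed

text \<open>The quotient of an algebra \<open>U\<close> by an ideal \<open>K\<close>. Decomposition
  into degrees is demanded only modulo \<open>K\<close>, and \<open>indep\<close> says both that it
  is unique there and that \<open>K\<close> is homogeneous. The laws are relativised to
  \<open>U\<close>, since in the application the unit law fails for functions that are nonzero on
  dependent sets.\<close>

locale graded_quotient = Vector_Spaces.vector_space sc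
  for sc :: "rat \<Rightarrow> 'v::ab_group_add \<Rightarrow> 'v" +
  fixes U K :: "'v set" and mul :: "'v \<Rightarrow> 'v \<Rightarrow> 'v" and one :: 'v
    and G :: "nat \<Rightarrow> 'v set" and k :: nat and code :: "'v \<Rightarrow> nat"
  assumes U: "subspace U" and K: "subspace K" and KU: "K \<subseteq> U"
    and mul_closed: "x \<in> U \<Longrightarrow> y \<in> U \<Longrightarrow> mul x y \<in> U"
    and mul_comm: "x \<in> U \<Longrightarrow> y \<in> U \<Longrightarrow> mul x y = mul y x"
    and mul_assoc: "x \<in> U \<Longrightarrow> y \<in> U \<Longrightarrow> z \<in> U \<Longrightarrow> mul (mul x y) z = mul x (mul y z)"
    and mul_add: "x \<in> U \<Longrightarrow> y \<in> U \<Longrightarrow> z \<in> U \<Longrightarrow> mul (x + y) z = mul x z + mul y z"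
    and mul_scale: "x \<in> U \<Longrightarrow> y \<in> U \<Longrightarrow> mul (sc q x) y = sc q (mul x y)"
    and one: "one \<in> U" and mul_one: "x \<in> U \<Longrightarrow> mul one x = x"
    and ideal: "x \<in> U \<Longrightarrow> y \<in> K \<Longrightarrow> mul x y \<in> K"
    and G: "subspace (G i)" and GU: "G i \<subseteq> U"
    and G_mul: "x \<in> G i \<Longrightarrow> y \<in> G j \<Longrightarrow> mul x y \<in> G (i + j)"
    and G_0: "G 0 = span {one}"
    and G_Suc: "G (Suc i) \<subseteq> span {mul x y | x y. x \<in> G 1 \<and> y \<in> G i}"
    and G_above: "k < i \<Longrightarrow> G i \<subseteq> K"
    and decomp: "x \<in> U \<Longrightarrow> \<exists>c. (\<forall>i. c i \<in> G i) \<and> x - (\<Sum>i\<le>k. c i) \<in> K"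
    and indep: "(\<And>i. c i \<in> G i) \<Longrightarrow> (\<Sum>i\<le>k. c i) \<in> K \<Longrightarrow> i \<le> k \<Longrightarrow> c i \<in> K"
    and one_K: "one \<notin> K"
    and code: "x \<in> U \<Longrightarrow> y \<in> U \<Longrightarrow> code x = code y \<longleftrightarrow> x - y \<in> K"
begin

text \<open>
  \<open>code\<close> identifies \<open>U / K\<close> with a set of natural numbers; \<open>dec\<close> picks representatives of its classes
  and is junk outside \<open>code ` U\<close>.
\<close>

definition dec :: "nat \<Rightarrow> 'v" where
  "dec n = (SOME x. x \<in> U \<and> code x = n)"

definition qalg :: "(rat, nat) module" where
  "qalg = \<lparr>carrier = code ` U, mult = (\<lambda>a b. code (mul (dec a) (dec b))), one = code one,
     zero = code 0, add = (\<lambda>a b. code (dec a + dec b)), smult = (\<lambda>q a. code (sc q (dec a)))\<rparr>"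

lemma dec: "x \<in> U \<Longrightarrow> dec (code x) \<in> U \<and> dec (code x) - x \<in> K"
proof -
  assume x: "x \<in> U"
  then have "dec (code x) \<in> U \<and> code (dec (code x)) = code x"
    unfolding dec_def by (intro someI[of "\<lambda>z. z \<in> U \<and> code z = code x"]) simp
  then show ?thesis using code x by blast
qed

lemmas U_closed = subspace_add[OF U] subspace_scale[OF U] subspace_0[OF U] subspace_neg[OF U]
  subspace_diff[OF U]

lemma code_eqI: "x \<in> U \<Longrightarrow> y \<in> U \<Longrightarrow> x - y \<in> K \<Longrightarrow> code x = code y"
  using code by blast

lemma qalg_carrier [simp]: "carrier qalg = code ` U"
  and qalg_one [simp]: "\<one>\<^bsub>qalg\<^esub> = code one"
  and qalg_zero [simp]: "\<zero>\<^bsub>qalg\<^esub> = code 0"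
  by (simp_all add: qalg_def)

lemma qalg_add: 
  assumes "x \<in> U" "y \<in> U" shows "code x \<oplus>\<^bsub>qalg\<^esub> code y = code (x + y)"
proof -
  have "(dec (code x) + dec (code y)) - (x + y) = (dec (code x) - x) + (dec (code y) - y)" by simp
  also have "\<dots> \<in> K" using dec assms subspace_add[OF K] by blast
  finally have "(dec (code x) + dec (code y)) - (x + y) \<in> K" .
  then show ?thesis unfolding qalg_def using dec assms U_closed by (simp add: code)
qed

lemma qalg_smult:
  assumes "x \<in> U" shows "q \<odot>\<^bsub>qalg\<^esub> code x = code (sc q x)"
proof -
  have "sc q (dec (code x)) - sc q x = sc q (dec (code x) - x)" by (simp add: scale_right_diff_distrib)
  also have "\<dots> \<in> K" using dec assms subspace_scale[OF K] by blast
  finally have "sc q (dec (code x)) - sc q x \<in> K" .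
  then show ?thesis unfolding qalg_def using dec assms U_closed by (simp add: code)
qed

lemma mul_diff:
  assumes "x \<in> U" "y \<in> U" "z \<in> U" shows "mul (x - y) z = mul x z - mul y z"
proof -
  have "mul (x - y + y) z = mul (x - y) z + mul y z" using assms by (intro mul_add U_closed)
  then show ?thesis by simp
qed

lemma qalg_mult:
  assumes "x \<in> U" "y \<in> U" shows "code x \<otimes>\<^bsub>qalg\<^esub> code y = code (mul x y)"
proof -
  let ?x = "dec (code x)" and ?y = "dec (code y)"
  have xy: "?x \<in> U" "?y \<in> U" "?x - x \<in> K" "?y - y \<in> K" using dec assms by auto
  have "mul (?x - x) ?y = mul ?x ?y - mul x ?y" using mul_diff xy assms by blast
  moreover have "mul x ?y = mul ?y x" "mul x y = mul y x" using mul_comm xy assms by auto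
  moreover have "mul (?y - y) x = mul ?y x - mul y x" using mul_diff xy assms by blast
  ultimately have "mul ?x ?y - mul x y = mul (?x - x) ?y + mul (?y - y) x" by simp
  also have "\<dots> = mul ?y (?x - x) + mul x (?y - y)"
    using mul_comm xy assms U_closed by auto
  also have "\<dots> \<in> K" using ideal xy assms subspace_add[OF K] by blast
  finally have "mul ?x ?y - mul x y \<in> K" .
  then show ?thesis unfolding qalg_def using xy assms mul_closed by (simp add: code)
qed

lemma algebra_qalg: "algebra (class_ring :: rat ring) qalg"
proof (rule algebraI)
  show "cring (class_ring :: rat ring)" by (rule class_cring.cring_axioms)
  show "cring qalg"
  proof (rule cringI)
    show "abelian_group qalg"
    proof (rule abelian_groupI)
      fix x assume "x \<in> carrier qalg"
      then obtain u where u: "u \<in> U" "x = code u" by auto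
      have "code (- u) \<in> carrier qalg \<and> code (- u) \<oplus>\<^bsub>qalg\<^esub> x = \<zero>\<^bsub>qalg\<^esub>"
        using u U_closed by (simp add: qalg_add)
      then show "\<exists>y\<in>carrier qalg. y \<oplus>\<^bsub>qalg\<^esub> x = \<zero>\<^bsub>qalg\<^esub>" by blast
    qed (use U_closed in \<open>auto simp: qalg_add add_ac\<close>)
    show "comm_monoid qalg"
    proof (rule comm_monoidI)
      show "x \<otimes>\<^bsub>qalg\<^esub> y = y \<otimes>\<^bsub>qalg\<^esub> x" if xy: "x \<in> carrier qalg" "y \<in> carrier qalg" for x y
      proof -
        obtain u v where "u \<in> U" "v \<in> U" "x = code u" "y = code v" using xy by auto
        then show ?thesis using mul_comm[of u v] by (simp add: qalg_mult)
      qed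
    qed (use one mul_closed in \<open>auto simp: qalg_mult mul_assoc mul_one\<close>)
  qed (use U_closed mul_closed in \<open>auto simp: qalg_add qalg_mult mul_add\<close>)
qed (use U_closed mul_closed mul_scale in
    \<open>auto simp: qalg_add qalg_mult qalg_smult scale_left_distrib scale_right_distrib\<close>)

sublocale qalg: algebra "class_ring :: rat ring" qalg
  by (rule algebra_qalg)

lemma vectorspace_qalg: "vectorspace (class_ring :: rat ring) qalg"
  by (intro vectorspace.intro qalg.module class_field)

lemma subspace_code:
  assumes "subspace H" "H \<subseteq> U"
  shows "VectorSpace.subspace (class_ring :: rat ring) (code ` H) qalg"
proof (intro VectorSpace.subspace.intro vectorspace_qalg submodule.intro qalg.module)
  show "code ` H \<subseteq> carrier qalg" using assms by auto
  show "\<zero>\<^bsub>qalg\<^esub> \<in> code ` H" using subspace_0[OF assms(1)] by simp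
  show "v \<oplus>\<^bsub>qalg\<^esub> w \<in> code ` H" if vw: "v \<in> code ` H" "w \<in> code ` H" for v w
  proof -
    obtain x y where xy: "x \<in> H" "y \<in> H" "v = code x" "w = code y" using vw by blast
    then have "x \<in> U" "y \<in> U" using assms(2) by auto
    then show ?thesis using xy subspace_add[OF assms(1)] by (simp add: qalg_add)
  qed
  show "c \<odot>\<^bsub>qalg\<^esub> v \<in> code ` H" if v: "v \<in> code ` H" for c v
  proof -
    obtain x where x: "x \<in> H" "v = code x" using v by blast
    then have "x \<in> U" using assms(2) by auto
    then show ?thesis using x subspace_scale[OF assms(1)] by (simp add: qalg_smult)
  qed
qed

lemma finsum_code:
  assumes H: "subspace H" "H \<subseteq> U" and f: "\<And>i. i \<in> I \<Longrightarrow> f i \<in> H" and I: "finite I"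
  shows "finsum (qalg\<lparr>carrier := code ` H\<rparr>) (\<lambda>i. code (f i)) I = code (sum f I)"
proof -
  interpret V: vectorspace "class_ring :: rat ring" "qalg\<lparr>carrier := code ` H\<rparr>"
    by (rule vectorspace.subspace_is_vs[OF vectorspace_qalg subspace_code[OF H]])
  show ?thesis using I f
  proof (induction I rule: finite_induct)
    case empty
    then show ?case using V.M.finsum_empty by simp
  next
    case (insert i I)
    have "finsum (qalg\<lparr>carrier := code ` H\<rparr>) (\<lambda>i. code (f i)) (insert i I) =
        code (f i) \<oplus>\<^bsub>qalg\<lparr>carrier := code ` H\<rparr>\<^esub> finsum (qalg\<lparr>carrier := code ` H\<rparr>) (\<lambda>i. code (f i)) I"
      using insert by (intro V.M.finsum_insert) auto
    also have "\<dots> = code (f i) \<oplus>\<^bsub>qalg\<^esub> code (sum f I)" using insert by simp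
    also have "\<dots> = code (f i + sum f I)"
      using insert.prems subspace_sum[OF H(1), of I f] H(2) by (intro qalg_add) auto
    finally show ?case using insert by simp
  qed
qed

lemma finsum_qalg_code:
  assumes "\<And>i. i \<in> I \<Longrightarrow> f i \<in> U" "finite I"
  shows "(\<Oplus>\<^bsub>qalg\<^esub>i\<in>I. code (f i)) = code (sum f I)"
proof -
  have eq: "qalg\<lparr>carrier := code ` U\<rparr> = qalg" by (simp add: qalg_def)
  show ?thesis using finsum_code[OF U subset_refl, of I f] assms unfolding eq by simp
qed

lemma graded_rat_algebra_qalg: "graded_rat_algebra qalg k (\<lambda>i. code ` G i)"
proof (intro graded_rat_algebra.intro graded_rat_algebra_axioms.intro algebra_qalg)
  show "VectorSpace.subspace class_ring (code ` G i) qalg" for i by (rule subspace_code[OF G GU])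
  show "code ` G i = {\<zero>\<^bsub>qalg\<^esub>}" if "k < i" for i
  proof
    show "code ` G i \<subseteq> {\<zero>\<^bsub>qalg\<^esub>}"
      using G_above[OF that] GU[of i] U_closed by (auto intro!: code_eqI)
    show "{\<zero>\<^bsub>qalg\<^esub>} \<subseteq> code ` G i" using subspace_0[OF G[of i]] by simp
  qed
  show "x \<otimes>\<^bsub>qalg\<^esub> y \<in> code ` G (i + j)" if xy: "x \<in> code ` G i" "y \<in> code ` G j" for x y i j
  proof -
    obtain u v where uv: "u \<in> G i" "v \<in> G j" "x = code u" "y = code v" using xy by blast
    then have "u \<in> U" "v \<in> U" using GU by auto
    then show ?thesis using uv G_mul by (simp add: qalg_mult)
  qed
  show "code ` G 0 = {q \<odot>\<^bsub>qalg\<^esub> \<one>\<^bsub>qalg\<^esub> |q. True}"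
    unfolding G_0 span_singleton qalg_one qalg_smult[OF one] by blast
  show "\<one>\<^bsub>qalg\<^esub> \<noteq> \<zero>\<^bsub>qalg\<^esub>" using code[OF one subspace_0[OF U]] one_K by simp
  fix x assume "x \<in> carrier qalg"
  then obtain u where u: "u \<in> U" "x = code u" by auto
  obtain c where c: "\<And>i. c i \<in> G i" "u - (\<Sum>i\<le>k. c i) \<in> K" using decomp[OF u(1)] by blast
  have cU: "(\<Sum>i\<le>k. c i) \<in> U" using c(1) GU by (intro subspace_sum[OF U]) blast
  show "\<exists>!c. c \<in> (\<Pi>\<^sub>E i\<in>{..k}. code ` G i) \<and> x = (\<Oplus>\<^bsub>qalg\<^esub>i\<in>{..k}. c i)"
  proof (rule ex1I)
    let ?c = "restrict (\<lambda>i. code (c i)) {..k}"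
    have cU1: "code (c i) \<in> code ` U" for i using c(1)[of i] GU[of i] by blast
    have "(\<Oplus>\<^bsub>qalg\<^esub>i\<in>{..k}. ?c i) = (\<Oplus>\<^bsub>qalg\<^esub>i\<in>{..k}. code (c i))"
      by (rule qalg.finsum_cong') (use cU1 in simp_all)
    also have "\<dots> = code (\<Sum>i\<le>k. c i)" using c(1) GU by (intro finsum_qalg_code) auto
    also have "\<dots> = x" using code_eqI[OF u(1) cU c(2)] u(2) by simp
    finally show "?c \<in> (\<Pi>\<^sub>E i\<in>{..k}. code ` G i) \<and> x = (\<Oplus>\<^bsub>qalg\<^esub>i\<in>{..k}. ?c i)"
      using c(1) by auto
    fix d assume d: "d \<in> (\<Pi>\<^sub>E i\<in>{..k}. code ` G i) \<and> x = (\<Oplus>\<^bsub>qalg\<^esub>i\<in>{..k}. d i)"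
    \<comment> \<open>\<open>indep\<close> asks for a member of \<open>G i\<close> in every degree,
      so the family is completed by 0 beyond \<open>k\<close>.\<close>
    have "\<exists>b. b \<in> G i \<and> (i \<le> k \<longrightarrow> d i = code b)" for i
      using d subspace_0[OF G[of i]] by (cases "i \<le> k") auto
    then obtain b where b: "\<And>i. b i \<in> G i" "\<And>i. i \<le> k \<Longrightarrow> d i = code (b i)" by metis
    have bU: "(\<Sum>i\<le>k. b i) \<in> U" using b(1) GU by (intro subspace_sum[OF U]) blast
    have "code (b i) \<in> carrier qalg" for i using b(1)[of i] GU[of i] by auto
    then have "(\<Oplus>\<^bsub>qalg\<^esub>i\<in>{..k}. d i) = (\<Oplus>\<^bsub>qalg\<^esub>i\<in>{..k}. code (b i))"
      using b(2) by (intro qalg.finsum_cong') auto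
    also have "\<dots> = code (\<Sum>i\<le>k. b i)" using b(1) GU by (intro finsum_qalg_code) auto
    finally have "code (\<Sum>i\<le>k. c i) = code (\<Sum>i\<le>k. b i)"
      using code_eqI[OF u(1) cU c(2)] u(2) d by simp
    then have "(\<Sum>i\<le>k. c i - b i) \<in> K" using code[OF cU bU] by (simp add: sum_subtractf)
    moreover have "c i - b i \<in> G i" for i using b(1) c(1) by (intro subspace_diff[OF G])
    ultimately have cb: "c i - b i \<in> K" if "i \<le> k" for i using indep[of "\<lambda>i. c i - b i"] that by blast
    show "d = ?c"
    proof (rule extensionalityI[of _ "{..k}"])
      show "d \<in> extensional {..k}" "?c \<in> extensional {..k}" using d by (auto simp: PiE_def)
      fix i assume i: "i \<in> {..k}"
      have "code (c i) = code (b i)"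
        using code_eqI[OF _ _ cb[of i]] b(1)[of i] c(1)[of i] GU[of i] i by auto
      then show "d i = ?c i" using b(2) i by simp
    qed
  qed
qed

lemma generated_qalg: "generated_in_degree_one qalg (\<lambda>i. code ` G i)"
proof -
  let ?H = "code ` G 0 \<union> code ` G 1"
  have HU: "?H \<subseteq> carrier qalg" using GU by auto
  let ?R = "generate_ring qalg ?H"
  have zero: "code 0 \<in> ?R" using qalg.zero_in_generate by simp
  have sub: "subspace {x \<in> U. code x \<in> ?R}"
  proof (rule subspaceI)
    show "0 \<in> {x \<in> U. code x \<in> ?R}" using zero U_closed by simp
    show "x + y \<in> {x \<in> U. code x \<in> ?R}"
      if "x \<in> {x \<in> U. code x \<in> ?R}" "y \<in> {x \<in> U. code x \<in> ?R}" for x y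
      using that generate_ring.eng_add[of "code x" qalg ?H "code y"] U_closed by (simp add: qalg_add)
    show "sc q x \<in> {x \<in> U. code x \<in> ?R}" if x: "x \<in> {x \<in> U. code x \<in> ?R}" for q x
    proof -
      \<comment> \<open>Generation as a ring provides no scalars; multiplication by \<open>q\<close>
        is realised by the degree-zero element \<open>sc q one\<close>.\<close>
      have "sc q one \<in> G 0" unfolding G_0 by (intro span_scale span_base) simp
      then have "code (sc q one) \<in> ?R" by (intro generate_ring.incl) blast
      then have "code (sc q one) \<otimes>\<^bsub>qalg\<^esub> code x \<in> ?R" using x by (intro generate_ring.eng_mult) auto
      also have "code (sc q one) \<otimes>\<^bsub>qalg\<^esub> code x = code (sc q x)"
        using x one U_closed by (simp add: qalg_mult mul_scale mul_one)
      finally show ?thesis using x U_closed by simp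
    qed
  qed
  have Gi: "G i \<subseteq> {x \<in> U. code x \<in> ?R}" for i
  proof (induction i)
    case 0
    then show ?case using GU by (auto intro: generate_ring.incl)
  next
    case (Suc i)
    have "mul x y \<in> {x \<in> U. code x \<in> ?R}" if "x \<in> G 1" "y \<in> G i" for x y
    proof -
      have xy: "x \<in> U" "y \<in> U" using that GU by auto
      have "code x \<in> ?R" using that by (intro generate_ring.incl) blast
      moreover have "code y \<in> ?R" using that Suc by blast
      ultimately have "code x \<otimes>\<^bsub>qalg\<^esub> code y \<in> ?R" by (rule generate_ring.eng_mult)
      then show ?thesis using xy mul_closed by (simp add: qalg_mult)
    qed
    then have "{mul x y | x y. x \<in> G 1 \<and> y \<in> G i} \<subseteq> {x \<in> U. code x \<in> ?R}" by blast
    then show ?case using span_minimal[OF _ sub] G_Suc by blast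
  qed
  have "code x \<in> ?R" if x: "x \<in> U" for x
  proof -
    obtain c where c: "\<And>i. c i \<in> G i" "x - (\<Sum>i\<le>k. c i) \<in> K" using decomp[OF x] by blast
    have cR: "(\<Sum>i\<le>k. c i) \<in> {x \<in> U. code x \<in> ?R}"
      using c(1) Gi by (intro subspace_sum[OF sub]) blast
    then have "code x = code (\<Sum>i\<le>k. c i)" using code_eqI[OF x _ c(2)] by simp
    then show ?thesis using cR by simp
  qed
  then show ?thesis
    unfolding generated_in_degree_one_def using qalg.generate_ring_incl[OF HU] by auto
qed

text \<open>A basis \<open>C\<close> of \<open>G i \<inter> K\<close> is extended to a basis
  \<open>D\<close> of \<open>G i\<close>; the codes of \<open>D - C\<close> then form a basis of the
  quotient.\<close>

lemma has_rat_dim_qalg: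
  assumes B: "finite B" "G i \<subseteq> span B"
  shows "has_rat_dim qalg (code ` G i) (int (dim (G i)) - int (dim (G i \<inter> K)))"
proof -
  interpret V: vectorspace "class_ring :: rat ring" "qalg\<lparr>carrier := code ` G i\<rparr>"
    by (rule vectorspace.subspace_is_vs[OF vectorspace_qalg subspace_code[OF G GU]])
  obtain C where C: "C \<subseteq> G i \<inter> K" "independent C" "G i \<inter> K \<subseteq> span C" "card C = dim (G i \<inter> K)"
    by (rule basis_exists)
  have "C \<subseteq> G i" using C(1) by blast
  then obtain D where D: "C \<subseteq> D" "D \<subseteq> G i" "independent D" "G i \<subseteq> span D"
    using maximal_independent_subset_extend[OF _ C(2)] by metis
  have finD: "finite D" using independent_span_bound[OF B(1) D(3)] D(2) B(2) by blast
  have finC: "finite C" using finD D(1) finite_subset by blast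
  have cardD: "card D = dim (G i)" using basis_card_eq_dim[OF D(2,4,3)] .
  let ?D = "D - C"
  have D'G: "?D \<subseteq> G i" and D'U: "?D \<subseteq> U" using D(2) GU by auto
  have finD': "finite ?D" using finD by simp
  have free: "q x = 0" if q: "(\<Sum>x\<in>?D. sc (q x) x) \<in> K" and x: "x \<in> ?D" for q x
  proof -
    have "(\<Sum>x\<in>?D. sc (q x) x) \<in> G i"
      using D'G by (intro subspace_sum[OF G] subspace_scale[OF G]) blast
    then have "(\<Sum>x\<in>?D. sc (q x) x) \<in> span C" using q C(3) by blast
    then obtain p where p: "(\<Sum>x\<in>?D. sc (q x) x) = (\<Sum>x\<in>C. sc (p x) x)"
      using span_finite[OF finC] by auto
    let ?u = "\<lambda>x. if x \<in> C then - p x else q x"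
    have "(\<Sum>x\<in>D. sc (?u x) x) = (\<Sum>x\<in>?D. sc (?u x) x) + (\<Sum>x\<in>C. sc (?u x) x)"
      using sum.subset_diff[OF D(1) finD] by blast
    also have "(\<Sum>x\<in>?D. sc (?u x) x) = (\<Sum>x\<in>?D. sc (q x) x)" by (rule sum.cong) auto
    also have "(\<Sum>x\<in>C. sc (?u x) x) = (\<Sum>x\<in>C. - sc (p x) x)"
      by (rule sum.cong) (simp_all add: scale_minus_left)
    finally have "(\<Sum>x\<in>D. sc (?u x) x) = 0" unfolding p by (simp add: sum_negf)
    then have "?u x = 0" using independentD[OF D(3) finD subset_refl, of ?u x] x by blast
    then show ?thesis using x by simp
  qed
  \<comment> \<open>Bases here are sets, so the count also requires that no two elements of
    \<open>?D\<close> share a code.\<close>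
  have inj: "inj_on code ?D"
  proof (rule inj_onI, rule ccontr)
    fix x y assume xy: "x \<in> ?D" "y \<in> ?D" "code x = code y" "x \<noteq> y"
    let ?q = "\<lambda>z. if z = x then 1 else if z = y then - 1 else 0 :: rat"
    have "(\<Sum>z\<in>?D. sc (?q z) z) = (\<Sum>z\<in>{x,y}. sc (?q z) z)"
      using xy finD' by (intro sum.mono_neutral_right) auto
    also have "\<dots> = x - y" using xy by simp
    also have "\<dots> \<in> K" using xy code D'U by blast
    finally have "?q x = 0" by (rule free[OF _ xy(1)])
    then show False by simp
  qed
  have lc: "V.lincomb a (code ` ?D) = code (\<Sum>x\<in>?D. sc (a (code x)) x)" for a
  proof -
    have "V.lincomb a (code ` ?D) =
        finsum (qalg\<lparr>carrier := code ` G i\<rparr>) (\<lambda>v. a v \<odot>\<^bsub>qalg\<^esub> v) (code ` ?D)"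
      unfolding V.lincomb_def by simp
    also have "\<dots> = finsum (qalg\<lparr>carrier := code ` G i\<rparr>) (\<lambda>x. a (code x) \<odot>\<^bsub>qalg\<^esub> code x) ?D"
    proof (rule V.M.finsum_reindex[OF _ inj])
      show "(\<lambda>v. a v \<odot>\<^bsub>qalg\<^esub> v) \<in> code ` ?D \<rightarrow> carrier (qalg\<lparr>carrier := code ` G i\<rparr>)"
        using D'G D'U subspace_scale[OF G] by (auto simp: qalg_smult subset_iff)
    qed
    also have "\<dots> = finsum (qalg\<lparr>carrier := code ` G i\<rparr>) (\<lambda>x. code (sc (a (code x)) x)) ?D"
      using D'G D'U subspace_scale[OF G]
      by (intro V.M.finsum_cong') (auto simp: qalg_smult subset_iff)
    also have "\<dots> = code (\<Sum>x\<in>?D. sc (a (code x)) x)"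
      using D'G by (intro finsum_code[OF G GU _ finD'] subspace_scale[OF G]) blast
    finally show ?thesis .
  qed
  have sumU: "(\<Sum>x\<in>?D. sc (q x) x) \<in> U" for q
    using D'U by (intro subspace_sum[OF U] subspace_scale[OF U]) blast
  have carr: "code ` ?D \<subseteq> carrier (qalg\<lparr>carrier := code ` G i\<rparr>)" using D'G by auto
  have li: "V.lin_indpt (code ` ?D)"
  proof (rule V.finite_lin_indpt2[OF _ carr])
    show "finite (code ` ?D)" using finD' by simp
    fix a assume "V.lincomb a (code ` ?D) = \<zero>\<^bsub>qalg\<lparr>carrier := code ` G i\<rparr>\<^esub>"
    then have "code (\<Sum>x\<in>?D. sc (a (code x)) x) = code 0" unfolding lc by simp
    then have "(\<Sum>x\<in>?D. sc (a (code x)) x) \<in> K"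
      using code[OF sumU subspace_0[OF U]] by simp
    then show "\<forall>v\<in>code ` ?D. a v = \<zero>\<^bsub>class_ring\<^esub>"
      using free[of "\<lambda>x. a (code x)"] by simp
  qed
  have gen: "V.span (code ` ?D) = carrier (qalg\<lparr>carrier := code ` G i\<rparr>)"
  proof
    show "V.span (code ` ?D) \<subseteq> carrier (qalg\<lparr>carrier := code ` G i\<rparr>)"
      by (rule V.span_is_subset2[OF carr])
    show "carrier (qalg\<lparr>carrier := code ` G i\<rparr>) \<subseteq> V.span (code ` ?D)"
    proof
      fix y assume "y \<in> carrier (qalg\<lparr>carrier := code ` G i\<rparr>)"
      then obtain x where x: "x \<in> G i" "y = code x" by auto
      obtain u where u: "x = (\<Sum>z\<in>D. sc (u z) z)"
        using x(1) D(4) span_finite[OF finD] by auto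
      have "x = (\<Sum>z\<in>?D. sc (u z) z) + (\<Sum>z\<in>C. sc (u z) z)"
        unfolding u by (rule sum.subset_diff[OF D(1) finD])
      moreover have "(\<Sum>z\<in>C. sc (u z) z) \<in> K"
        using C(1) by (intro subspace_sum[OF K] subspace_scale[OF K]) blast
      ultimately have "x - (\<Sum>z\<in>?D. sc (u z) z) \<in> K" by simp
      then have "y = code (\<Sum>z\<in>?D. sc (u z) z)"
        using code_eqI[OF _ sumU] x GU by blast
      \<comment> \<open>Coefficients in the quotient are indexed by codes, so \<open>u\<close> is
        transported along the inverse of \<open>code\<close> on \<open>?D\<close>.\<close>
      also have "(\<Sum>z\<in>?D. sc (u z) z) = (\<Sum>z\<in>?D. sc ((u \<circ> the_inv_into ?D code) (code z)) z)"
        by (rule sum.cong) (simp_all add: the_inv_into_f_f[OF inj])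
      also have "code \<dots> = V.lincomb (u \<circ> the_inv_into ?D code) (code ` ?D)" by (rule lc[symmetric])
      also have "\<dots> \<in> V.span (code ` ?D)"
        unfolding V.span_def using finD' by (auto intro!: exI)
      finally show "y \<in> V.span (code ` ?D)" .
    qed
  qed
  have "V.basis (code ` ?D)" unfolding V.basis_def using li gen carr by blast
  then have "V.dim = card (code ` ?D)" using V.dim_basis finD' by blast
  also have "\<dots> = card D - card C" using card_image[OF inj] card_Diff_subset[OF finC D(1)] by simp
  finally have "int V.dim = int (dim (G i)) - int (dim (G i \<inter> K))"
    using cardD C(4) card_mono[OF finD D(1)] by simp
  moreover have "V.fin_dim" unfolding V.fin_dim_def using finD' gen carr by blast
  ultimately show ?thesis unfolding has_rat_dim_def by blast
qed

end

section \<open>The Macaulay vector of a space of relations\<close>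

lemma countable_funs_on:
  assumes "finite X" shows "countable (funs_on X)"
  using assms
proof (induction X rule: finite_induct)
  case empty
  have "funs_on {} \<subseteq> {0 :: 'a \<Rightarrow> rat}" by (auto simp: funs_on_def fun_eq_iff)
  then show ?case by (rule countable_subset) simp
next
  case (insert x X)
  have "funs_on (insert x X) \<subseteq> (\<lambda>(q, v). v(x := q)) ` (UNIV \<times> funs_on X)"
  proof
    fix v assume v: "v \<in> funs_on (insert x X)"
    show "v \<in> (\<lambda>(q, v). v(x := q)) ` (UNIV \<times> funs_on X)"
    proof (rule image_eqI[of _ _ "(v x, v(x := 0))"])
      show "(v x, v(x := 0)) \<in> UNIV \<times> funs_on X" using v by (auto simp: funs_on_def)
    qed simp
  qed
  then show ?case by (rule countable_subset) (simp add: insert.IH)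
qed

definition hom_part :: "nat \<Rightarrow> ('a set \<Rightarrow> rat) \<Rightarrow> 'a set \<Rightarrow> rat" where
  "hom_part i v S = (if card S = i then v S else 0)"

lemma flinear_hom_part: "flinear (hom_part i)"
  by (rule flinearI) (auto simp: hom_part_def fun_eq_iff fscale_apply)

lemma hom_part_sum: "hom_part j (\<Sum>i\<in>I. v i) = (\<Sum>i\<in>I. hom_part j (v i))"
  by (rule ext) (simp add: hom_part_def sum_fun_apply)

context relation_space
begin

lemma unit_mul: "(\<And>S. v S \<noteq> 0 \<Longrightarrow> ind S) \<Longrightarrow> mul unit_fn v = v"
  by (rule conv_unit) (auto intro: ind_finite)

lemma hom_part_mul:
  "hom_part n (mul v w) = (\<Sum>i\<le>n. mul (hom_part i v) (hom_part (n - i) w))"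
proof
  fix S
  show "hom_part n (mul v w) S = (\<Sum>i\<le>n. mul (hom_part i v) (hom_part (n - i) w)) S"
  proof (cases "ind S")
    case False
    then show ?thesis by (simp add: hom_part_def sum_fun_apply conv_def)
  next
    case True
    then have fin: "finite S" by (rule ind_finite)
    have "(\<Sum>i\<le>n. mul (hom_part i v) (hom_part (n - i) w)) S =
        (\<Sum>i\<le>n. \<Sum>T\<in>Pow S. hom_part i v T * hom_part (n - i) w (S - T))"
      using True by (simp add: sum_fun_apply conv_def)
    also have "\<dots> = (\<Sum>T\<in>Pow S. \<Sum>i\<le>n. hom_part i v T * hom_part (n - i) w (S - T))"
      by (rule sum.swap)
    also have "\<dots> = (\<Sum>T\<in>Pow S. if card S = n then v T * w (S - T) else 0)"
    proof (rule sum.cong[OF refl])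
      fix T assume "T \<in> Pow S"
      then have T: "T \<subseteq> S" "finite T" using fin finite_subset by auto
      have cS: "card T + card (S - T) = card S"
        using T fin by (simp add: card_Diff_subset card_mono)
      have "(\<Sum>i\<le>n. hom_part i v T * hom_part (n - i) w (S - T)) =
          (\<Sum>i\<le>n. if i = card T then (if card S = n then v T * w (S - T) else 0) else 0)"
        using cS by (intro sum.cong) (auto simp: hom_part_def)
      also have "\<dots> = (if card S = n then v T * w (S - T) else 0)"
        using cS by auto
      finally show "(\<Sum>i\<le>n. hom_part i v T * hom_part (n - i) w (S - T)) =
          (if card S = n then v T * w (S - T) else 0)" .
    qed
    also have "\<dots> = hom_part n (mul v w) S" using True by (simp add: hom_part_def conv_def)
    finally show ?thesis by simp
  qed
qed

lemma hom_part_rel_alg: "v \<in> rel_alg E L i \<Longrightarrow> hom_part j v = (if i = j then v else 0)"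
  using rel_alg_supp[of v i] by (auto simp: hom_part_def fun_eq_iff)

lemma flinear_conv_left: "flinear (\<lambda>x. conv \<Delta> x y)"
  by (rule flinearI) (simp_all add: conv_add_left conv_scale_left)

lemma mul_rel_alg: "x \<in> rel_alg E L i \<Longrightarrow> y \<in> rel_alg E L j \<Longrightarrow> mul x y \<in> rel_alg E L (i + j)"
proof (induction i arbitrary: x)
  case 0
  have "mul unit_fn y = y" using rel_alg_supp[OF 0(2)] by (intro unit_mul) blast
  then have "{unit_fn} \<subseteq> {x. mul x y \<in> rel_alg E L j}" using 0(2) by simp
  then have "fs.span {unit_fn} \<subseteq> {x. mul x y \<in> rel_alg E L j}"
    by (rule fs.span_minimal[OF _ flinear_subspace_preimage[OF flinear_conv_left subspace_rel_alg]])
  then show ?case using 0(1) by auto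
next
  case (Suc i)
  have "mul (mul (lin_fn c) v) y \<in> rel_alg E L (Suc i + j)" if "c \<in> L" "v \<in> rel_alg E L i" for c v
    unfolding mul_assoc add_Suc by (rule mul_lin_rel_alg[OF that(1) Suc.IH[OF that(2) Suc.prems(2)]])
  then have "{mul (lin_fn c) v |c v. c \<in> L \<and> v \<in> rel_alg E L i} \<subseteq> {x. mul x y \<in> rel_alg E L (Suc i + j)}"
    by blast
  then have "rel_alg E L (Suc i) \<subseteq> {x. mul x y \<in> rel_alg E L (Suc i + j)}"
    unfolding rel_alg.simps(2)[of E L i]
    by (rule fs.span_minimal[OF _ flinear_subspace_preimage[OF flinear_conv_left subspace_rel_alg]])
  then show ?case using Suc.prems(1) by blast
qed

lemma rel_alg_Suc_subset:
  "rel_alg E L (Suc i) \<subseteq> fs.span {mul x y | x y. x \<in> rel_alg E L 1 \<and> y \<in> rel_alg E L i}"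
  unfolding rel_alg.simps(2)[of E L i]
proof (rule fs.span_mono, rule subsetI)
  fix z assume "z \<in> {mul (lin_fn c) v |c v. c \<in> L \<and> v \<in> rel_alg E L i}"
  then obtain c v where cv: "z = mul (lin_fn c) v" "c \<in> L" "v \<in> rel_alg E L i" by blast
  have "mul unit_fn v = v" using rel_alg_supp[OF cv(3)] by (intro unit_mul) blast
  \<comment> \<open>\<open>lin_fn c\<close> may be nonzero at a loop and thus lie outside the
    algebra; its product with the unit is cut off at independent sets and belongs to degree
    one.\<close>
  then have "z = mul (mul (lin_fn c) unit_fn) v" using cv(1) by (simp add: mul_assoc)
  moreover have "mul (lin_fn c) unit_fn \<in> rel_alg E L 1"
    using mul_lin_rel_alg[OF cv(2), of unit_fn 0] by (simp add: fs.span_base)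
  ultimately show "z \<in> {mul x y | x y. x \<in> rel_alg E L 1 \<and> y \<in> rel_alg E L i}" using cv(3) by blast
qed

section \<open>The algebra, the ideal generated by w and its truncation\<close>

definition alg_sum :: "('a set \<Rightarrow> rat) set" where
  "alg_sum = {v. \<forall>i. hom_part i v \<in> rel_alg E L i}"

text \<open>The part of degree \<open>i\<close> of the ideal (w); degree 0 is separate because a
  nonzero multiple of a degree-one element starts in degree 1.\<close>

definition multiples :: "('a \<Rightarrow> rat) \<Rightarrow> nat \<Rightarrow> ('a set \<Rightarrow> rat) set" where
  "multiples w i = (case i of 0 \<Rightarrow> {0} | Suc j \<Rightarrow> mul (lin_fn w) ` rel_alg E L j)"

text \<open>The ideal generated by \<open>w\<close> together with everything in degrees above
  \<open>k\<close>: leaving those components of an element of \<open>alg_sum\<close> free truncates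
  the quotient.\<close>

definition quot_ideal :: "nat \<Rightarrow> ('a \<Rightarrow> rat) \<Rightarrow> ('a set \<Rightarrow> rat) set" where
  "quot_ideal k w = {v \<in> alg_sum. \<forall>i\<le>k. hom_part i v \<in> multiples w i}"

lemma alg_sum_supp: "v \<in> alg_sum \<Longrightarrow> v S \<noteq> 0 \<Longrightarrow> ind S"
proof -
  assume v: "v \<in> alg_sum" "v S \<noteq> 0"
  then have "hom_part (card S) v \<in> rel_alg E L (card S)" "hom_part (card S) v S \<noteq> 0"
    by (auto simp: alg_sum_def hom_part_def)
  then show "ind S" using rel_alg_supp by blast
qed

lemma subspace_alg_sum: "fs.subspace alg_sum"
  unfolding alg_sum_def
  by (rule fs.subspaceI)
     (auto simp: flinear_add[OF flinear_hom_part] flinear_scale[OF flinear_hom_part]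
       flinear_zero[OF flinear_hom_part] simp del: rel_alg.simps
       intro: fs.subspace_add[OF subspace_rel_alg] fs.subspace_scale[OF subspace_rel_alg]
         fs.subspace_0[OF subspace_rel_alg])

lemma rel_alg_alg_sum: "rel_alg E L i \<subseteq> alg_sum"
  unfolding alg_sum_def
  using hom_part_rel_alg fs.subspace_0[OF subspace_rel_alg] by (auto simp del: rel_alg.simps)

lemma mul_alg_sum: "x \<in> alg_sum \<Longrightarrow> y \<in> alg_sum \<Longrightarrow> mul x y \<in> alg_sum"
proof -
  assume xy: "x \<in> alg_sum" "y \<in> alg_sum"
  have "hom_part n (mul x y) \<in> rel_alg E L n" for n
    unfolding hom_part_mul
  proof (rule fs.subspace_sum[OF subspace_rel_alg])
    fix i assume "i \<in> {..n}"
    then show "mul (hom_part i x) (hom_part (n - i) y) \<in> rel_alg E L n"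
      using mul_rel_alg[of "hom_part i x" i "hom_part (n - i) y" "n - i"] xy
      unfolding alg_sum_def by simp
  qed
  then show "mul x y \<in> alg_sum" by (simp add: alg_sum_def)
qed

lemma subspace_multiples: "fs.subspace (multiples w i)"
  unfolding multiples_def
  by (cases i) (auto simp: fs.subspace_single_0 simp del: rel_alg.simps
    intro!: flinear_subspace_image[OF flinear_conv] subspace_rel_alg)

lemma multiples_subset: "w \<in> L \<Longrightarrow> multiples w i \<subseteq> rel_alg E L i"
  unfolding multiples_def
  by (cases i) (auto simp: fs.subspace_0[OF subspace_rel_alg] mul_lin_rel_alg fs.span_zero
    simp del: rel_alg.simps)

lemma subspace_quot_ideal: "fs.subspace (quot_ideal k w)"
  unfolding quot_ideal_def
  by (rule fs.subspaceI)
     (auto simp: flinear_add[OF flinear_hom_part] flinear_scale[OF flinear_hom_part]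
       flinear_zero[OF flinear_hom_part] fs.subspace_0[OF subspace_multiples]
       intro: fs.subspace_add[OF subspace_multiples] fs.subspace_scale[OF subspace_multiples]
         fs.subspace_0[OF subspace_alg_sum] fs.subspace_add[OF subspace_alg_sum]
         fs.subspace_scale[OF subspace_alg_sum])

lemma mul_multiples:
  assumes "x \<in> rel_alg E L i" "y \<in> multiples w j"
  shows "mul x y \<in> multiples w (i + j)"
proof (cases j)
  case 0
  then have "mul x y = 0" using assms(2) by (simp add: multiples_def)
  then show ?thesis using fs.subspace_0[OF subspace_multiples] by simp
next
  case (Suc l)
  then obtain z where z: "z \<in> rel_alg E L l" "y = mul (lin_fn w) z"
    using assms(2) by (auto simp: multiples_def)
  have "mul x y = mul (lin_fn w) (mul x z)" unfolding z(2) by (rule mul_left_commute)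
  moreover have "mul x z \<in> rel_alg E L (i + l)" by (rule mul_rel_alg[OF assms(1) z(1)])
  ultimately show ?thesis using Suc by (simp add: multiples_def)
qed

lemma mul_quot_ideal:
  assumes x: "x \<in> alg_sum" and y: "y \<in> quot_ideal k w"
  shows "mul x y \<in> quot_ideal k w"
proof -
  have "hom_part n (mul x y) \<in> multiples w n" if n: "n \<le> k" for n
    unfolding hom_part_mul
  proof (rule fs.subspace_sum[OF subspace_multiples])
    fix i assume i: "i \<in> {..n}"
    have "hom_part i x \<in> rel_alg E L i" using x by (simp add: alg_sum_def)
    moreover have "hom_part (n - i) y \<in> multiples w (n - i)"
      using y n by (simp add: quot_ideal_def)
    ultimately have "mul (hom_part i x) (hom_part (n - i) y) \<in> multiples w (i + (n - i))"
      by (rule mul_multiples)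
    then show "mul (hom_part i x) (hom_part (n - i) y) \<in> multiples w n" using i by simp
  qed
  moreover have "mul x y \<in> alg_sum" using x y mul_alg_sum by (simp add: quot_ideal_def)
  ultimately show ?thesis by (simp add: quot_ideal_def)
qed

lemma rel_alg_quot_ideal_iff:
  assumes "v \<in> rel_alg E L i"
  shows "v \<in> quot_ideal k w \<longleftrightarrow> (i \<le> k \<longrightarrow> v \<in> multiples w i)"
proof -
  have "v \<in> alg_sum" using assms rel_alg_alg_sum by blast
  then show ?thesis
    unfolding quot_ideal_def using hom_part_rel_alg[OF assms] fs.subspace_0[OF subspace_multiples]
    by auto
qed

lemma ex_graded_quotient:
  "\<exists>code. graded_quotient fscale alg_sum (quot_ideal k w) mul unit_fn (rel_alg E L) k code"
proof -
  have alg_sum_outside: "alg_sum \<subseteq> funs_on (Pow E)"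
  proof
    fix v assume v: "v \<in> alg_sum"
    have "v S = 0" if "S \<notin> Pow E" for S
      using alg_sum_supp[OF v, of S] that by (auto simp: rel_indep_def)
    then show "v \<in> funs_on (Pow E)" by (simp add: funs_on_def)
  qed
  have "countable alg_sum"
    by (rule countable_subset[OF alg_sum_outside countable_funs_on[OF finite_Pow_E]])
  then have "\<exists>code :: _ \<Rightarrow> nat. \<forall>x\<in>alg_sum. \<forall>y\<in>alg_sum. code x = code y \<longleftrightarrow> x - y \<in> quot_ideal k w"
    by (rule ex_countable_quotient_code)
       (use fs.subspace_0[OF subspace_quot_ideal] fs.subspace_diff[OF subspace_quot_ideal] in auto)
  then obtain code :: "('a set \<Rightarrow> rat) \<Rightarrow> nat" where
    code: "\<And>x y. x \<in> alg_sum \<Longrightarrow> y \<in> alg_sum \<Longrightarrow> code x = code y \<longleftrightarrow> x - y \<in> quot_ideal k w" by blast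
  have unit: "unit_fn \<in> rel_alg E L 0" by (simp add: fs.span_base)
  have sum_hom: "hom_part j (\<Sum>i\<le>k. c i) = c j" if "\<And>i. c i \<in> rel_alg E L i" "j \<le> k" for c j
  proof -
    have "hom_part j (\<Sum>i\<le>k. c i) = (\<Sum>i\<le>k. if i = j then c j else 0)"
      unfolding hom_part_sum using hom_part_rel_alg[OF that(1)] by (intro sum.cong) auto
    also have "\<dots> = c j" using that(2) by simp
    finally show ?thesis .
  qed
  have "graded_quotient fscale alg_sum (quot_ideal k w) mul unit_fn (rel_alg E L) k code"
  proof (intro graded_quotient.intro graded_quotient_axioms.intro fs.vector_space_axioms
      subspace_alg_sum subspace_quot_ideal subspace_rel_alg rel_alg_alg_sum rel_alg_Suc_subset)
    show "quot_ideal k w \<subseteq> alg_sum" by (auto simp: quot_ideal_def)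
    show "unit_fn \<in> alg_sum" using unit rel_alg_alg_sum by blast
    show "mul x y \<in> alg_sum" if "x \<in> alg_sum" "y \<in> alg_sum" for x y by (rule mul_alg_sum[OF that])
    show "mul x y = mul y x" for x y by (rule conv_commute)
    show "mul (mul x y) z = mul x (mul y z)" for x y z by (rule mul_assoc)
    show "mul (x + y) z = mul x z + mul y z" for x y z by (rule conv_add_left)
    show "mul (fscale q x) y = fscale q (mul x y)" for q x y by (rule conv_scale_left)
    show "mul unit_fn x = x" if "x \<in> alg_sum" for x by (rule unit_mul) (rule alg_sum_supp[OF that])
    show "mul x y \<in> quot_ideal k w" if "x \<in> alg_sum" "y \<in> quot_ideal k w" for x y
      by (rule mul_quot_ideal[OF that])
    show "mul x y \<in> rel_alg E L (i + j)" if "x \<in> rel_alg E L i" "y \<in> rel_alg E L j" for x y i j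
      by (rule mul_rel_alg[OF that])
    show "rel_alg E L 0 = fs.span {unit_fn}" by simp
    show "rel_alg E L i \<subseteq> quot_ideal k w" if "k < i" for i
      using rel_alg_quot_ideal_iff that by (meson leD subsetI)
    show "code x = code y \<longleftrightarrow> x - y \<in> quot_ideal k w" if "x \<in> alg_sum" "y \<in> alg_sum" for x y
      by (rule code[OF that])
    show "unit_fn \<notin> quot_ideal k w"
    proof -
      have "unit_fn \<noteq> (0 :: 'a set \<Rightarrow> rat)" by (auto simp: unit_fn_def fun_eq_iff)
      then show ?thesis using rel_alg_quot_ideal_iff[OF unit] by (simp add: multiples_def)
    qed
    show "\<exists>c. (\<forall>i. c i \<in> rel_alg E L i) \<and> x - (\<Sum>i\<le>k. c i) \<in> quot_ideal k w" if x: "x \<in> alg_sum" for x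
    proof (intro exI[of _ "\<lambda>i. hom_part i x"] conjI allI)
      show c: "hom_part i x \<in> rel_alg E L i" for i using x by (simp add: alg_sum_def)
      have "(\<Sum>i\<le>k. hom_part i x) \<in> alg_sum"
        using c rel_alg_alg_sum by (intro fs.subspace_sum[OF subspace_alg_sum]) blast
      then have "x - (\<Sum>i\<le>k. hom_part i x) \<in> alg_sum"
        using x by (intro fs.subspace_diff[OF subspace_alg_sum])
      moreover have "hom_part j (x - (\<Sum>i\<le>k. hom_part i x)) \<in> multiples w j" if j: "j \<le> k" for j
      proof -
        have "hom_part j (\<Sum>i\<le>k. hom_part i x) = hom_part j x"
          using sum_hom[of "\<lambda>i. hom_part i x" j] c j by blast
        then have "hom_part j (x - (\<Sum>i\<le>k. hom_part i x)) = 0"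
          by (auto simp: fun_eq_iff hom_part_def split: if_splits)
        then show ?thesis using fs.subspace_0[OF subspace_multiples] by simp
      qed
      ultimately show "x - (\<Sum>i\<le>k. hom_part i x) \<in> quot_ideal k w" by (simp add: quot_ideal_def)
    qed
    show "c i \<in> quot_ideal k w"
      if c: "\<And>i. c i \<in> rel_alg E L i" "(\<Sum>i\<le>k. c i) \<in> quot_ideal k w" "i \<le> k" for c i
    proof -
      have "c i \<in> multiples w i"
        using c(2,3) sum_hom[OF c(1) c(3)] unfolding quot_ideal_def by force
      then show ?thesis using rel_alg_quot_ideal_iff[OF c(1)] by blast
    qed
  qed
  then show ?thesis by blast
qed

text \<open>The ideal in degree \<open>i\<close> is the image of degree \<open>i - 1\<close> under
  \<open>w\<close>, so injectivity below degree \<open>k\<close> fixes its dimension in all degrees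
  from 1 to \<open>k\<close>.\<close>

lemma macaulay_vector_rel_alg:
  assumes w: "w \<in> L" and inj: "\<And>i v. i < k \<Longrightarrow> v \<in> rel_alg E L i \<Longrightarrow> mul (lin_fn w) v = 0 \<Longrightarrow> v = 0"
    and g: "\<And>i. 1 \<le> i \<Longrightarrow> i \<le> k \<Longrightarrow> g i = int (fs.dim (rel_alg E L i)) - int (fs.dim (rel_alg E L (i - 1)))"
  shows "macaulay_vector k g"
proof -
  obtain code where
    "graded_quotient fscale alg_sum (quot_ideal k w) mul unit_fn (rel_alg E L) k code"
    using ex_graded_quotient by blast
  then interpret Q: graded_quotient fscale alg_sum "quot_ideal k w" mul unit_fn "rel_alg E L" k code .
  have "has_rat_dim Q.qalg (code ` rel_alg E L i) (g i)" if i: "i \<in> {1..k}" for i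
  proof -
    obtain j where j: "i = Suc j" using i by (cases i) auto
    have ik: "i \<le> k" "1 \<le> i" "j < k" using i j by auto
    have "rel_alg E L i \<inter> quot_ideal k w = multiples w i"
      using rel_alg_quot_ideal_iff[of _ i k w] multiples_subset[OF w, of i] ik(1) by blast
    also have "\<dots> = mul (lin_fn w) ` rel_alg E L j" by (simp add: j multiples_def)
    finally have K: "rel_alg E L i \<inter> quot_ideal k w = mul (lin_fn w) ` rel_alg E L j" .
    have "{v \<in> rel_alg E L j. mul (lin_fn w) v = 0} \<subseteq> fs.span {}" using inj[OF ik(3)] by auto
    then have "fs.dim {v \<in> rel_alg E L j. mul (lin_fn w) v = 0} \<le> card ({} :: ('a set \<Rightarrow> rat) set)"
      by (intro fs.dim_le_card) auto
    then have "fs.dim (rel_alg E L j) = fs.dim (mul (lin_fn w) ` rel_alg E L j)"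
      using rank_nullity_supported[OF finite_Pow_E rel_alg_outside subspace_rel_alg flinear_conv, of j ind "lin_fn w"]
      by simp
    moreover obtain B :: "('a set \<Rightarrow> rat) set" where "finite B" "funs_on (Pow E) \<subseteq> fs.span B"
      using span_supported[OF finite_Pow_E] by metis
    then have "has_rat_dim Q.qalg (code ` rel_alg E L i)
        (int (fs.dim (rel_alg E L i)) - int (fs.dim (rel_alg E L i \<inter> quot_ideal k w)))"
      using rel_alg_outside[of i] by (intro Q.has_rat_dim_qalg[of B]) auto
    ultimately show ?thesis using g[OF ik(2,1)] j K by simp
  qed
  then show ?thesis
    unfolding macaulay_vector_def using Q.graded_rat_algebra_qalg Q.generated_qalg by blast
qed

end

section \<open>Represented matroids\<close>

definition relations :: "nat \<Rightarrow> ('a \<Rightarrow> int vec) \<Rightarrow> 'a set \<Rightarrow> ('a \<Rightarrow> rat) set" where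
  "relations m b E = {c. (\<forall>x. x \<notin> E \<longrightarrow> c x = 0) \<and>
     (\<forall>j<m. (\<Sum>e\<in>E. c e * rat_of_int (b e $ j)) = 0)}"

lemma relation_space_relations:
  assumes "finite E" shows "relation_space E (relations m b E)"
proof
  show "finite E" by fact
  show "c x = 0" if "c \<in> relations m b E" "x \<notin> E" for c x
    using that by (simp add: relations_def)
  show "fs.subspace (relations m b E)"
  proof (rule fs.subspaceI)
    show "0 \<in> relations m b E" by (simp add: relations_def)
    show "x + y \<in> relations m b E" if "x \<in> relations m b E" "y \<in> relations m b E" for x y
      using that by (simp add: relations_def distrib_right sum.distrib)
    show "fscale q x \<in> relations m b E" if "x \<in> relations m b E" for q x
      using that by (simp add: relations_def fscale_apply mult.assoc sum_distrib_left[symmetric])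
  qed
qed

text \<open>One side speaks of a set of vectors, the other of coefficient families on
  \<open>E\<close>; injectivity of the subfamily lets coefficients pass between the two.\<close>

lemma lin_indep_subfamily_iff:
  assumes E: "finite E" and b: "\<forall>e\<in>E. b e \<in> carrier_vec m" and I: "I \<subseteq> E"
  shows "lin_indep_subfamily m b I \<longleftrightarrow> rel_indep E (relations m b E) I"
proof -
  interpret V: vec_space "TYPE(rat)" m .
  let ?r = "\<lambda>e. rat_vec (b e)"
  have r: "?r e \<in> carrier_vec m" if "e \<in> E" for e using b that by (simp add: rat_vec_def)
  have r_idx: "?r e $ j = rat_of_int (b e $ j)" if "e \<in> E" "j < m" for e j
    using b that by (auto simp: rat_vec_def)
  have finI: "finite I" using I E finite_subset by blast
  have rI: "?r ` A \<subseteq> carrier_vec m" if "A \<subseteq> I" for A using r I that by blast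
  have sumE: "(\<Sum>e\<in>E. c e * rat_of_int (b e $ j)) = (\<Sum>e\<in>I. c e * ?r e $ j)"
    if "\<And>x. x \<notin> I \<Longrightarrow> c x = 0" "j < m" for c j
  proof -
    have "(\<Sum>e\<in>E. c e * rat_of_int (b e $ j)) = (\<Sum>e\<in>I. c e * rat_of_int (b e $ j))"
      using that(1) I E by (intro sum.mono_neutral_right) auto
    also have "\<dots> = (\<Sum>e\<in>I. c e * ?r e $ j)"
      using that(2) I by (intro sum.cong) (auto simp: r_idx)
    finally show ?thesis .
  qed
  show ?thesis
  proof
    assume lin: "lin_indep_subfamily m b I"
    then have inj: "inj_on ?r I" and li: "V.lin_indpt (?r ` I)"
      by (auto simp: lin_indep_subfamily_def)
    show "rel_indep E (relations m b E) I"
      unfolding rel_indep_def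
    proof (intro conjI ballI impI I)
      fix c assume c: "c \<in> relations m b E" "\<forall>x. x \<notin> I \<longrightarrow> c x = 0"
      let ?a = "\<lambda>v. c (the_inv_into I ?r v)"
      have a: "?a (?r e) = c e" if "e \<in> I" for e using the_inv_into_f_f[OF inj that] by simp
      have "V.lincomb ?a (?r ` I) = 0\<^sub>v m"
      proof (rule eq_vecI)
        show "dim_vec (V.lincomb ?a (?r ` I)) = dim_vec (0\<^sub>v m)"
          using V.lincomb_dim[of "?r ` I" ?a] finI rI[of I] by simp
        fix j assume "j < dim_vec (0\<^sub>v m :: rat vec)"
        then have j: "j < m" by simp
        have "V.lincomb ?a (?r ` I) $ j = (\<Sum>v\<in>?r ` I. ?a v * v $ j)"
          by (rule V.lincomb_index[OF j]) (rule rI, simp)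
        also have "\<dots> = (\<Sum>e\<in>I. ?a (?r e) * ?r e $ j)" by (simp add: sum.reindex[OF inj])
        also have "\<dots> = (\<Sum>e\<in>I. c e * ?r e $ j)" using a by (intro sum.cong) auto
        also have "\<dots> = (\<Sum>e\<in>E. c e * rat_of_int (b e $ j))" using sumE[of c j] c(2) j by simp
        also have "\<dots> = 0" using c(1) j by (simp add: relations_def)
        finally show "V.lincomb ?a (?r ` I) $ j = 0\<^sub>v m $ j" using j by simp
      qed
      then have "?a v = 0" if "v \<in> ?r ` I" for v
        using li V.lin_dep_crit[of "?r ` I" "?r ` I" v ?a] finI that by auto
      then have "c e = 0" if "e \<in> I" for e using a that by auto
      then show "c = 0" using c(2) by (auto simp: fun_eq_iff)
    qed
  next
    assume ind: "rel_indep E (relations m b E) I"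
    have zero: "c e = 0"
      if c: "\<And>x. x \<notin> I \<Longrightarrow> c x = 0" "\<And>j. j < m \<Longrightarrow> (\<Sum>e\<in>I. c e * ?r e $ j) = 0" for c e
    proof -
      have "c \<in> relations m b E"
        using c I sumE[of c] unfolding relations_def by auto
      then have "c = 0" using ind c(1) unfolding rel_indep_def by blast
      then show ?thesis by simp
    qed
    have inj: "inj_on ?r I"
    proof (rule inj_onI, rule ccontr)
      fix e f assume ef: "e \<in> I" "f \<in> I" "?r e = ?r f" "e \<noteq> f"
      \<comment> \<open>Two elements with the same vector support this nonzero relation.\<close>
      let ?c = "\<lambda>x. if x = e then 1 else if x = f then - 1 else 0 :: rat"
      have "(\<Sum>x\<in>I. ?c x * ?r x $ j) = 0" for j
      proof -
        have "(\<Sum>x\<in>I. ?c x * ?r x $ j) = (\<Sum>x\<in>{e, f}. ?c x * ?r x $ j)"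
          using ef(1,2) finI by (intro sum.mono_neutral_right) auto
        also have "\<dots> = ?r e $ j - ?r f $ j" using ef(4) by simp
        also have "\<dots> = 0" unfolding ef(3) by simp
        finally show ?thesis .
      qed
      then have "?c e = 0" using zero[of ?c e] ef(1,2) by fastforce
      then show False by simp
    qed
    have "V.lin_indpt (?r ` I)"
    proof (rule V.finite_lin_indpt2)
      show "finite (?r ` I)" using finI by simp
      show "?r ` I \<subseteq> carrier_vec m" by (rule rI) simp
      fix a assume a: "V.lincomb a (?r ` I) = 0\<^sub>v m"
      let ?c = "\<lambda>e. if e \<in> I then a (?r e) else 0"
      have "(\<Sum>e\<in>I. ?c e * ?r e $ j) = 0" if j: "j < m" for j
      proof -
        have "(\<Sum>e\<in>I. ?c e * ?r e $ j) = (\<Sum>e\<in>I. a (?r e) * ?r e $ j)" by (rule sum.cong) auto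
        also have "\<dots> = (\<Sum>v\<in>?r ` I. a v * v $ j)" by (simp add: sum.reindex[OF inj])
        also have "\<dots> = V.lincomb a (?r ` I) $ j"
          by (rule V.lincomb_index[OF j, symmetric]) (rule rI, simp)
        finally show ?thesis using a j by simp
      qed
      then have c0: "?c e = 0" for e by (rule zero[of ?c e, rotated]) simp_all
      show "\<forall>v\<in>?r ` I. a v = 0"
      proof
        fix v assume "v \<in> ?r ` I"
        then obtain e where "e \<in> I" "v = ?r e" by blast
        then show "a v = 0" using c0[of e] by simp
      qed
    qed
    then show "lin_indep_subfamily m b I" using inj by (simp add: lin_indep_subfamily_def)
  qed
qed

text \<open>A rational vector space is not a finite union of proper subspaces. Elements are treated
  one at a time: a generic multiple of \<open>u\<close> makes the value at \<open>e\<close> nonzero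
  and spoils none of the earlier ones.\<close>

lemma (in relation_space) ex_nowhere_zero:
  assumes "\<And>e. e \<in> E \<Longrightarrow> \<exists>c\<in>L. c e \<noteq> 0"
  obtains w where "w \<in> L" "\<And>e. e \<in> E \<Longrightarrow> w e \<noteq> 0"
proof -
  have "\<exists>c\<in>L. \<forall>e\<in>F. c e \<noteq> 0" if "F \<subseteq> E" for F
    using finite_subset[OF that finite_E] that
  proof (induction F rule: finite_induct)
    case empty
    then show ?case using fs.subspace_0[OF subspace_L] by blast
  next
    case (insert e F)
    then obtain c where c: "c \<in> L" "\<forall>x\<in>F. c x \<noteq> 0" by blast
    obtain u where u: "u \<in> L" "u e \<noteq> 0" using assms insert.prems by blast
    \<comment> \<open>Where \<open>u x = 0\<close> the quotient is 0 by convention and merely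
      forbids \<open>q = 0\<close>; at such \<open>x\<close> the nonzero value \<open>c x\<close> is
      left unchanged.\<close>
    have "finite ((\<lambda>x. - c x / u x) ` insert e F)" using insert.hyps by simp
    then obtain q where q: "q \<notin> (\<lambda>x. - c x / u x) ` insert e F"
      using ex_new_if_finite[OF infinite_UNIV_char_0] by blast
    have "(c + fscale q u) x \<noteq> 0" if x: "x \<in> insert e F" for x
    proof (cases "u x = 0")
      case True
      then show ?thesis using x c u(2) by (auto simp: fscale_apply)
    next
      case False
      have "q \<noteq> - c x / u x" using q x by blast
      then show ?thesis using False by (auto simp: fscale_apply field_simps add_eq_0_iff)
    qed
    moreover have "c + fscale q u \<in> L"
      using c(1) u(1) by (intro fs.subspace_add[OF subspace_L] fs.subspace_scale[OF subspace_L])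
    ultimately show ?case by blast
  qed
  then show ?thesis using that by blast
qed

lemma (in matroid) finite_indep: "finite {I. indep I}"
  by (rule finite_subset[of _ "Pow E"]) (use indep_subset_ground finite_ground in auto)

text \<open>Purity of the independence complex; it supplies the large set \<open>B\<close> demanded
  by \<open>mul_lin_injective\<close>.\<close>

lemma (in matroid) extend_to_rank:
  assumes "indep S"
  shows "\<exists>B. S \<subseteq> B \<and> indep B \<and> card B = matroid_rank indep"
proof -
  have fin: "finite (card ` {I. indep I})" using finite_indep by simp
  have le: "card I \<le> matroid_rank indep" if "indep I" for I
    unfolding matroid_rank_def using fin that by (intro Max_ge) auto
  have "matroid_rank indep \<in> card ` {I. indep I}"
    unfolding matroid_rank_def using fin indep_empty by (intro Max_in) auto
  then obtain J where J: "indep J" "card J = matroid_rank indep" by auto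
  show ?thesis using assms
  proof (induction "matroid_rank indep - card S" arbitrary: S rule: less_induct)
    case less
    show ?case
    proof (cases "card S = matroid_rank indep")
      case True
      then show ?thesis using less.prems by blast
    next
      case False
      then have lt: "card S < card J" using le[OF less.prems] J(2) by simp
      then obtain x where x: "x \<in> J - S" "indep (insert x S)"
        using indep_augment[OF less.prems J(1)] by blast
      have "finite S" using indep_subset_ground[OF less.prems] finite_ground finite_subset by blast
      then have "matroid_rank indep - card (insert x S) < matroid_rank indep - card S"
        using x(1) lt J(2) by simp
      then obtain B where "insert x S \<subseteq> B" "indep B" "card B = matroid_rank indep"
        using less.hyps[OF _ x(2)] by blast
      then show ?thesis by blast
    qed
  qed
qed

lemma (in matroid) h_polynomial_eq:
  "h_polynomial indep = (\<Sum>S | indep S. [:-1, 1:] ^ (matroid_rank indep - card S))"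
proof -
  let ?m = "matroid_rank indep"
  have le: "card I \<le> ?m" if "indep I" for I
    unfolding matroid_rank_def using finite_indep that by (intro Max_ge) auto
  have "(\<Sum>S | indep S. [:-1, 1:] ^ (?m - card S)) =
      (\<Sum>i\<le>?m. \<Sum>S\<in>{S \<in> {S. indep S}. card S = i}. [:-1, 1 :: int:] ^ (?m - card S))"
    by (rule sum.group[symmetric]) (use finite_indep le in auto)
  also have "\<dots> = (\<Sum>i\<le>?m. of_nat (indep_count indep i) * [:-1, 1:] ^ (?m - i))"
  proof (rule sum.cong[OF refl])
    fix i
    have "(\<Sum>S\<in>{S \<in> {S. indep S}. card S = i}. [:-1, 1 :: int:] ^ (?m - card S)) =
        (\<Sum>S\<in>{S. indep S \<and> card S = i}. [:-1, 1 :: int:] ^ (?m - i))"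
      by (rule sum.cong) auto
    then show "(\<Sum>S\<in>{S \<in> {S. indep S}. card S = i}. [:-1, 1 :: int:] ^ (?m - card S)) =
        of_nat (indep_count indep i) * [:-1, 1:] ^ (?m - i)"
      by (simp add: indep_count_def)
  qed
  finally show ?thesis by (simp add: h_polynomial_def)
qed

lemma coeff_sum_of_nat_monom:
  assumes "i \<le> m"
  shows "Polynomial.coeff (\<Sum>j\<le>m. of_nat (a j) * Polynomial.monom (1::int) (m - j)) (m - i) = int (a i)"
proof -
  have "Polynomial.coeff (\<Sum>j\<le>m. of_nat (a j) * Polynomial.monom (1::int) (m - j)) (m - i) =
      (\<Sum>j\<le>m. if j = i then int (a i) else 0)"
    unfolding coeff_sum using assms by (intro sum.cong) (auto simp: of_nat_poly)
  then show ?thesis using assms by simp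
qed

theorem theorem7p4:
  fixes E :: "'a set" and indep :: "'a set \<Rightarrow> bool"
    and n d :: nat and b :: "'a \<Rightarrow> int vec"
  assumes "matroid E indep"
    and "card E = n" and "d \<le> n" and "matroid_rank indep = n - d"
    and "rationally_represents (n - d) b E indep"
    and "\<And>e. \<not> coloop E indep e"
  shows "macaulay_vector ((n - d) div 2) (g_number indep)"
proof -
  interpret M: matroid E indep by (rule assms(1))
  define m where "m = n - d"
  define k where "k = m div 2"
  define L where "L = relations m b E"
  interpret relation_space E L
    unfolding L_def by (rule relation_space_relations[OF M.finite_ground])
  have rep: "\<forall>e\<in>E. b e \<in> carrier_vec m" "\<And>I. I \<subseteq> E \<Longrightarrow> indep I \<longleftrightarrow> lin_indep_subfamily m b I"
    using assms(5) unfolding rationally_represents_def m_def by auto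
  have ind: "indep I \<longleftrightarrow> ind I" for I
  proof (cases "I \<subseteq> E")
    case True
    show ?thesis
      using rep(2)[OF True] lin_indep_subfamily_iff[OF M.finite_ground rep(1) True] L_def by simp
  next
    case False
    then show ?thesis using M.indep_subset_ground unfolding rel_indep_def by blast
  qed
  have rank: "matroid_rank indep = m" using assms(4) m_def by simp
  let ?y = "[:-1, 1:] :: int poly"
  let ?a = "\<lambda>i. fs.dim (rel_alg E L i)"
  obtain r where r: "\<And>S. ind S \<Longrightarrow> card S \<le> r" "\<exists>S. ind S \<and> card S = r"
    "(\<Sum>S | ind S. ?y ^ (r - card S)) = (\<Sum>i\<le>r. of_nat (?a i) * (?y + 1) ^ (r - i))"
    using rel_hilbert[OF relation_space_axioms, of ?y] by blast
  have "r = m"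
  proof (rule antisym)
    obtain S where "ind S" "card S = r" using r(2) by blast
    then show "r \<le> m" using M.extend_to_rank[of S] ind rank
      by (metis M.finite_ground M.indep_subset_ground card_mono finite_subset)
    obtain B where "indep B" "card B = m" using M.extend_to_rank[OF M.indep_empty] rank by blast
    then show "m \<le> r" using r(1) ind by blast
  qed
  \<comment> \<open>With y = t - 1 the identity of \<open>rel_hilbert\<close> becomes the defining
    identity of the h-vector, and comparing coefficients gives h_i.\<close>
  have y1: "?y + 1 = Polynomial.monom 1 1" by (simp add: one_pCons monom_altdef)
  have "h_polynomial indep = (\<Sum>i\<le>m. of_nat (?a i) * Polynomial.monom 1 (m - i))"
    using r(3) unfolding M.h_polynomial_eq rank \<open>r = m\<close> y1 ind by (simp add: monom_power)
  then have h: "h_number indep i = int (?a i)" if "i \<le> m" for i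
    unfolding h_number_def rank using coeff_sum_of_nat_monom[OF that] by simp
  have "\<exists>c\<in>L. c e \<noteq> 0" if e: "e \<in> E" for e
  proof -
    obtain B where B: "matroid_basis indep B" "e \<notin> B" using assms(6)[of e] e unfolding coloop_def by blast
    \<comment> \<open>A basis avoiding \<open>e\<close> becomes dependent when \<open>e\<close> is
      added, and the relation responsible must involve \<open>e\<close>.\<close>
    then have iB: "ind B" "\<not> ind (insert e B)" unfolding matroid_basis_def ind by blast+
    then obtain c where c: "c \<in> L" "\<forall>x. x \<notin> insert e B \<longrightarrow> c x = 0" "c \<noteq> 0"
      using e unfolding rel_indep_def by blast
    have "c e \<noteq> 0"
    proof
      assume "c e = 0"
      then have "\<forall>x. x \<notin> B \<longrightarrow> c x = 0" using c(2) by auto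
      then show False using iB(1) c(1,3) unfolding rel_indep_def by blast
    qed
    then show ?thesis using c(1) by blast
  qed
  then obtain w where w: "w \<in> L" "\<And>e. e \<in> E \<Longrightarrow> w e \<noteq> 0" using ex_nowhere_zero by blast
  have "macaulay_vector k (g_number indep)"
  proof (rule macaulay_vector_rel_alg[OF w(1)])
    show "g_number indep i = int (?a i) - int (?a (i - 1))" if "1 \<le> i" "i \<le> k" for i
    proof -
      have "i \<le> m" "i - 1 \<le> m" using that unfolding k_def by linarith+
      then show ?thesis unfolding g_number_def by (simp only: h)
    qed
    fix i v assume i: "i < k" and v: "v \<in> rel_alg E L i" and zero: "mul (lin_fn w) v = 0"
    show "v = 0"
    proof (rule mul_lin_injective[OF w(2) _ _ zero])
      show "ind S \<and> card S = i" if "v S \<noteq> 0" for S using rel_alg_supp[OF v that] .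
      fix S assume "ind S"
      then obtain B where "S \<subseteq> B" "ind B" "card B = m" using M.extend_to_rank[of S] ind rank by auto
      \<comment> \<open>Since \<open>i < m div 2\<close>, a basis containing \<open>S\<close> has at
        least \<open>i + 1\<close> further elements.\<close>
      moreover have "2 * i + 1 \<le> m" using i unfolding k_def by linarith
      ultimately show "\<exists>B. S \<subseteq> B \<and> ind B \<and> 2 * i + 1 \<le> card B" by blast
    qed
  qed
  then show ?thesis unfolding k_def m_def .
qed

end
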